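(* Let $x: M \to \overline{M}[4\rho]$ be an isometric immersion with non-zero parallel mean curvature vector, and suppose that $x$ is of a general type. Let $z$ be a local complex coordinate on the Riemann surface $M_0$. Then there is a coordinate transformation $w=w(z)$ on the Riemann surface $M_{0}$ such that, writing $\phi = \mu\, dw$, $\mu$ is a complex valued function of the single real variable $(w+\bar{w})/2$.
   Context: $\overline{M}[4\rho]$ is a complex two-dimensional complex space form of constant holomorphic sectional curvature $4\rho$. $M$ is an oriented connected real two-dimensional Riemannian manifold with Gaussian curvature $K$; $x: M\to\overline{M}[4\rho]$ is an isometric immersion with Kaehler angle $\alpha\in[0,\pi]$ whose mean curvature vector $H$ (half the trace of the second fundamental form) is non-zero and parallel for the normal connection; $b>0$ is the constant with $2b=|H|$. $M_0$ is the open dense subset of points of $M$ at which $x$ is neither holomorphic ($\alpha=0$) nor anti-holomorphic ($\alpha=\pi$); so $\sin\alpha\neq0$ on $M_0$. On $M_0$ there is (Ogata) a local field of unitary coframes $\{\omega_1,\omega_2\}$, unique up to orientations of $\overline M[4\rho]$ and $M_0$, such that, restricted to $x$, the metric is $ds^2=\phi\bar\phi$ with $\phi=\cos\frac{\alpha}{2}\,\omega_1+\sin\frac{\alpha}{2}\,\bar\omega_2$ ($\phi$ is unique up to sign and conjugacy), together with complex valued functions $a$ and $c$ on $M_0$ that determine the second fundamental form of $x$ and satisfy the structure equations $$d\alpha=(a+b)\phi+(\bar a+b)\bar\phi,\qquad d\phi=(\bar a-b)\cot\alpha\;\phi\wedge\bar\phi,\qquad K=-4(|a|^2-b^2)+6\rho\cos^2\alpha,$$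 $$da\wedge\phi=-\Bigl(2a(\bar a-b)\cot\alpha+\tfrac32\rho\sin\alpha\cos\alpha\Bigr)\phi\wedge\bar\phi,\qquad dc\wedge\bar\phi=2c(a-b)\cot\alpha\;\phi\wedge\bar\phi,$$ $$|c|^2=|a|^2+\tfrac{\rho}{2}(-2+3\sin^2\alpha).$$ $M_0$ is regarded as a Riemann surface via isothermal coordinates of $\phi\bar\phi$, so that $\phi=\lambda\,dz$ with $\lambda\neq0$ for a local complex coordinate $z$. The immersion $x$ is called of a general type if $d\alpha\neq0$ and $a\neq\bar a$ on $M_0$. Known fact (from earlier work): if $x$ is of a general type, then $a$ is a function $a=a(\alpha)$ of $\alpha$ with $a+b\neq0$, satisfying $$\frac{da}{d\alpha}=\frac{\cot\alpha}{\overline{a(\alpha)}+b}\Bigl(-2ba(\alpha)+2|a(\alpha)|^2+\tfrac{3\rho}{2}\sin^2\alpha\Bigr),$$ and $\alpha$ satisfies $\alpha_{z\bar z}-F(\alpha)\alpha_z\alpha_{\bar z}=0$, where $$F(\alpha)=\frac{(a(\alpha)-b)(\overline{a(\alpha)}-b)+\frac{3\rho}{2}\sin^2\alpha}{(a(\alpha)+b)(\overline{a(\alpha)}+b)}\cot\alpha.$$ *)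

theory Defs
  imports "HOL-Analysis.Analysis"
begin

section \<open>Smooth manifolds with charts in a Euclidean space\<close>

text \<open>Only meaningful for open \<open>S\<close>, which is the only way these are used.\<close>

fun Ck_on :: "nat \<Rightarrow> 'a::euclidean_space set \<Rightarrow> ('a \<Rightarrow> 'b::real_normed_vector) \<Rightarrow> bool" where
  "Ck_on 0 S f \<longleftrightarrow> continuous_on S f"
| "Ck_on (Suc n) S f \<longleftrightarrow>
     (\<forall>y\<in>S. f differentiable (at y)) \<and> (\<forall>v. Ck_on n S (\<lambda>y. frechet_derivative f (at y) v))"

definition smooth_on :: "'a::euclidean_space set \<Rightarrow> ('a \<Rightarrow> 'b::real_normed_vector) \<Rightarrow> bool" where
  "smooth_on S f \<longleftrightarrow> (\<forall>n. Ck_on n S f)"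

type_synonym ('p, 'e) chart = "'p set \<times> ('p \<Rightarrow> 'e)"

definition charts_at :: "('p, 'e) chart set \<Rightarrow> 'p \<Rightarrow> ('p, 'e) chart set" where
  "charts_at A p = {k \<in> A. p \<in> fst k}"

definition smooth_in :: "('p, 'e::euclidean_space) chart \<Rightarrow> 'p set \<Rightarrow> ('p \<Rightarrow> 'b::real_normed_vector) \<Rightarrow> bool" where
  "smooth_in k W f \<longleftrightarrow> smooth_on (snd k ` (fst k \<inter> W)) (\<lambda>y. f (inv_into (fst k) (snd k) y))"

text \<open>\<open>coord_deriv k f p u\<close> is \<open>df\<^sub>p(u)\<close>, the tangent vector \<open>u\<close> at \<open>p\<close> being given by its
  components in the chart \<open>k\<close>. All tensor fields below are likewise given by their components:
  they take a chart, a point of its domain, and component vectors.\<close>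

definition coord_deriv ::
    "('p, 'e::euclidean_space) chart \<Rightarrow> ('p \<Rightarrow> 'b::real_normed_vector) \<Rightarrow> 'p \<Rightarrow> 'e \<Rightarrow> 'b" where
  "coord_deriv k f p u = frechet_derivative (\<lambda>y. f (inv_into (fst k) (snd k) y)) (at (snd k p)) u"

record ('p, 'e) riem =
  mtop :: "'p topology"
  atlas :: "('p, 'e) chart set"
  metric :: "('p, 'e) chart \<Rightarrow> 'p \<Rightarrow> 'e \<Rightarrow> 'e \<Rightarrow> real"

definition smooth_fn ::
    "('p, 'e::euclidean_space) riem \<Rightarrow> 'p set \<Rightarrow> ('p \<Rightarrow> 'b::real_normed_vector) \<Rightarrow> bool" where
  "smooth_fn M W f \<longleftrightarrow> (\<forall>k\<in>atlas M. smooth_in k W f)"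

definition smooth_manifold :: "('p, 'e::euclidean_space) riem \<Rightarrow> bool" where
  "smooth_manifold M \<longleftrightarrow>
     Hausdorff_space (mtop M) \<and> second_countable (mtop M) \<and>
     topspace (mtop M) = (\<Union>k\<in>atlas M. fst k) \<and>
     (\<forall>k\<in>atlas M. openin (mtop M) (fst k) \<and> open (snd k ` fst k) \<and>
        homeomorphic_map (subtopology (mtop M) (fst k)) (top_of_set (snd k ` fst k)) (snd k)) \<and>
     (\<forall>k\<in>atlas M. \<forall>k'\<in>atlas M. smooth_in k (fst k') (snd k'))"

definition riemannian_manifold :: "('p, 'e::euclidean_space) riem \<Rightarrow> bool" where
  "riemannian_manifold M \<longleftrightarrow>
     smooth_manifold M \<and>
     (\<forall>k\<in>atlas M. \<forall>u v. smooth_in k UNIV (\<lambda>p. metric M k p u v)) \<and>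
     (\<forall>p\<in>topspace (mtop M). \<forall>k\<in>charts_at (atlas M) p.
        bilinear (metric M k p) \<and>
        (\<forall>u v. metric M k p u v = metric M k p v u) \<and>
        (\<forall>u. u \<noteq> 0 \<longrightarrow> metric M k p u u > 0) \<and>
        (\<forall>k'\<in>charts_at (atlas M) p. \<forall>u v. metric M k p u v =
           metric M k' p (coord_deriv k (snd k') p u) (coord_deriv k (snd k') p v)))"

text \<open>Christoffel symbols of the Levi-Civita connection (Koszul formula for coordinate fields):
  \<open>\<Gamma>(u,v) = \<nabla>\<^sub>u v\<close> for the coordinate fields with constant components \<open>u\<close>, \<open>v\<close>.\<close>

definition christoffel ::
    "('p, 'e::euclidean_space) riem \<Rightarrow> ('p, 'e) chart \<Rightarrow> 'p \<Rightarrow> 'e \<Rightarrow> 'e \<Rightarrow> 'e" where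
  "christoffel M k p u v = (THE w. \<forall>x. 2 * metric M k p w x =
       coord_deriv k (\<lambda>q. metric M k q v x) p u
     + coord_deriv k (\<lambda>q. metric M k q u x) p v
     - coord_deriv k (\<lambda>q. metric M k q u v) p x)"

text \<open>\<open>R(u,v)w = \<nabla>\<^sub>u\<nabla>\<^sub>v w - \<nabla>\<^sub>v\<nabla>\<^sub>u w\<close> for coordinate fields.\<close>

definition curvature ::
    "('p, 'e::euclidean_space) riem \<Rightarrow> ('p, 'e) chart \<Rightarrow> 'p \<Rightarrow> 'e \<Rightarrow> 'e \<Rightarrow> 'e \<Rightarrow> 'e" where
  "curvature M k p u v w =
       coord_deriv k (\<lambda>q. christoffel M k q v w) p u
     - coord_deriv k (\<lambda>q. christoffel M k q u w) p v
     + christoffel M k p u (christoffel M k p v w)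
     - christoffel M k p v (christoffel M k p u w)"


section \<open>The surface and the ambient complex space form\<close>

text \<open>Charts of the surface take values in \<open>\<complex> = \<real>\<^sup>2\<close>, with positively oriented real basis
  \<open>1, \<i>\<close>; the charts are \<^emph>\<open>not\<close> assumed to be isothermal. For a real-linear map \<open>T\<close> of \<open>\<complex>\<close>,
  \<open>Im (cnj (T 1) * T \<i>)\<close> is its determinant.\<close>

definition oriented_surface :: "('m, complex) riem \<Rightarrow> bool" where
  "oriented_surface M \<longleftrightarrow>
     riemannian_manifold M \<and> connected_space (mtop M) \<and>
     (\<forall>p\<in>topspace (mtop M). \<forall>k\<in>charts_at (atlas M) p. \<forall>k'\<in>charts_at (atlas M) p.
        Im (cnj (coord_deriv k (snd k') p 1) * coord_deriv k (snd k') p \<i>) > 0)"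

definition gram_det :: "('m, complex) riem \<Rightarrow> ('m, complex) chart \<Rightarrow> 'm \<Rightarrow> real" where
  "gram_det M k p = metric M k p 1 1 * metric M k p \<i> \<i> - (metric M k p 1 \<i>)\<^sup>2"

definition gauss_curvature :: "('m, complex) riem \<Rightarrow> ('m, complex) chart \<Rightarrow> 'm \<Rightarrow> real" where
  "gauss_curvature M k p = metric M k p (curvature M k p 1 \<i> \<i>) 1 / gram_det M k p"

abbreviation Jmul :: "complex^2 \<Rightarrow> complex^2" where
  "Jmul v \<equiv> \<i> *s v"

definition kaehler_surface :: "('n, complex^2) riem \<Rightarrow> bool" where
  "kaehler_surface N \<longleftrightarrow>
     riemannian_manifold N \<and>
     (\<forall>q\<in>topspace (mtop N). \<forall>l\<in>charts_at (atlas N) q.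
        (\<forall>l'\<in>charts_at (atlas N) q. \<forall>v.
           coord_deriv l (snd l') q (Jmul v) = Jmul (coord_deriv l (snd l') q v)) \<and>
        (\<forall>u v. metric N l q (Jmul u) (Jmul v) = metric N l q u v) \<and>
        (\<forall>u v. christoffel N l q u (Jmul v) = Jmul (christoffel N l q u v)))"

text \<open>Constant holomorphic sectional curvature \<open>4\<rho>\<close>; neither completeness nor simple
  connectedness is required.\<close>

definition complex_space_form :: "real \<Rightarrow> ('n, complex^2) riem \<Rightarrow> bool" where
  "complex_space_form \<rho> N \<longleftrightarrow>
     kaehler_surface N \<and>
     (\<forall>q\<in>topspace (mtop N). \<forall>l\<in>charts_at (atlas N) q. \<forall>u.
        metric N l q (curvature N l q u (Jmul u) (Jmul u)) u = 4 * \<rho> * (metric N l q u u)\<^sup>2)"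


section \<open>Isometric immersions with parallel mean curvature vector\<close>

definition push :: "('m \<Rightarrow> 'n) \<Rightarrow> ('m, complex) chart \<Rightarrow> ('n, complex^2) chart \<Rightarrow> 'm
    \<Rightarrow> complex \<Rightarrow> complex^2" where
  "push x k l p u = coord_deriv k (\<lambda>q. snd l (x q)) p u"

text \<open>Being isometric for definite metrics, such a map is automatically an immersion.\<close>

definition isometric_immersion ::
    "('m, complex) riem \<Rightarrow> ('n, complex^2) riem \<Rightarrow> ('m \<Rightarrow> 'n) \<Rightarrow> bool" where
  "isometric_immersion M N x \<longleftrightarrow>
     continuous_map (mtop M) (mtop N) x \<and>
     (\<forall>l\<in>atlas N. smooth_fn M {p \<in> topspace (mtop M). x p \<in> fst l} (\<lambda>p. snd l (x p))) \<and>
     (\<forall>p\<in>topspace (mtop M). \<forall>k\<in>charts_at (atlas M) p. \<forall>l\<in>charts_at (atlas N) (x p). \<forall>u v.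
        metric M k p u v = metric N l (x p) (push x k l p u) (push x k l p v))"

definition second_fundamental_form ::
    "('m, complex) riem \<Rightarrow> ('n, complex^2) riem \<Rightarrow> ('m \<Rightarrow> 'n)
     \<Rightarrow> ('m, complex) chart \<Rightarrow> ('n, complex^2) chart \<Rightarrow> 'm \<Rightarrow> complex \<Rightarrow> complex \<Rightarrow> complex^2" where
  "second_fundamental_form M N x k l p u v =
     coord_deriv k (\<lambda>q. push x k l q v) p u
     + christoffel N l (x p) (push x k l p u) (push x k l p v)
     - push x k l p (christoffel M k p u v)"

text \<open>Half the metric trace, written with the inverse Gram matrix of the basis \<open>1, \<i>\<close>.\<close>

definition mean_curvature ::
    "('m, complex) riem \<Rightarrow> ('n, complex^2) riem \<Rightarrow> ('m \<Rightarrow> 'n)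
     \<Rightarrow> ('m, complex) chart \<Rightarrow> ('n, complex^2) chart \<Rightarrow> 'm \<Rightarrow> complex^2" where
  "mean_curvature M N x k l p =
     (1 / (2 * gram_det M k p)) *\<^sub>R
       (metric M k p \<i> \<i> *\<^sub>R second_fundamental_form M N x k l p 1 1
        - (2 * metric M k p 1 \<i>) *\<^sub>R second_fundamental_form M N x k l p 1 \<i>
        + metric M k p 1 1 *\<^sub>R second_fundamental_form M N x k l p \<i> \<i>)"

definition parallel_mean_curvature ::
    "('m, complex) riem \<Rightarrow> ('n, complex^2) riem \<Rightarrow> ('m \<Rightarrow> 'n) \<Rightarrow> bool" where
  "parallel_mean_curvature M N x \<longleftrightarrow>
     (\<forall>p\<in>topspace (mtop M). \<forall>k\<in>charts_at (atlas M) p. \<forall>l\<in>charts_at (atlas N) (x p). \<forall>u n.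
        (\<forall>v. metric N l (x p) n (push x k l p v) = 0) \<longrightarrow>
        metric N l (x p) n
          (coord_deriv k (mean_curvature M N x k l) p u
           + christoffel N l (x p) (push x k l p u) (mean_curvature M N x k l p)) = 0)"

definition mean_curvature_length ::
    "('m, complex) riem \<Rightarrow> ('n, complex^2) riem \<Rightarrow> ('m \<Rightarrow> 'n) \<Rightarrow> real \<Rightarrow> bool" where
  "mean_curvature_length M N x h \<longleftrightarrow>
     (\<forall>p\<in>topspace (mtop M). \<forall>k\<in>charts_at (atlas M) p. \<forall>l\<in>charts_at (atlas N) (x p).
        sqrt (metric N l (x p) (mean_curvature M N x k l p) (mean_curvature M N x k l p)) = h)"

text \<open>The pullback of the Kaehler form \<open>\<langle>Ju, v\<rangle>\<close> is \<open>cos \<alpha>\<close> times the oriented area form.\<close>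

definition kaehler_angle ::
    "('m, complex) riem \<Rightarrow> ('n, complex^2) riem \<Rightarrow> ('m \<Rightarrow> 'n) \<Rightarrow> ('m \<Rightarrow> real) \<Rightarrow> bool" where
  "kaehler_angle M N x \<alpha> \<longleftrightarrow>
     (\<forall>p\<in>topspace (mtop M). 0 \<le> \<alpha> p \<and> \<alpha> p \<le> pi \<and>
        (\<forall>k\<in>charts_at (atlas M) p. \<forall>l\<in>charts_at (atlas N) (x p).
           metric N l (x p) (Jmul (push x k l p 1)) (push x k l p \<i>)
             = cos (\<alpha> p) * sqrt (gram_det M k p)))"

definition generic_part :: "('m, complex) riem \<Rightarrow> ('m \<Rightarrow> real) \<Rightarrow> 'm set" where
  "generic_part M \<alpha> = {p \<in> topspace (mtop M). \<alpha> p \<noteq> 0 \<and> \<alpha> p \<noteq> pi}"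


section \<open>Ogata's adapted coframe and structure equations\<close>

type_synonym 'm form1 = "('m, complex) chart \<Rightarrow> 'm \<Rightarrow> complex \<Rightarrow> complex"

definition wedge :: "(complex \<Rightarrow> complex) \<Rightarrow> (complex \<Rightarrow> complex) \<Rightarrow> complex \<Rightarrow> complex \<Rightarrow> complex" where
  "wedge \<zeta> \<eta> u v = \<zeta> u * \<eta> v - \<zeta> v * \<eta> u"

definition ext_deriv :: "'m form1 \<Rightarrow> ('m, complex) chart \<Rightarrow> 'm \<Rightarrow> complex \<Rightarrow> complex \<Rightarrow> complex" where
  "ext_deriv \<zeta> k p u v = coord_deriv k (\<lambda>q. \<zeta> k q v) p u - coord_deriv k (\<lambda>q. \<zeta> k q u) p v"

text \<open>A smooth field along \<open>x\<close>, over \<open>W\<close>, of unitary coframes \<open>\<omega>\<^sub>1, \<omega>\<^sub>2\<close> of the ambient space: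
  complex linear forms with \<open>|\<omega>\<^sub>1|\<^sup>2 + |\<omega>\<^sub>2|\<^sup>2\<close> the ambient metric.\<close>

definition unitary_coframe_along ::
    "('m, complex) riem \<Rightarrow> ('n, complex^2) riem \<Rightarrow> ('m \<Rightarrow> 'n) \<Rightarrow> 'm set
     \<Rightarrow> (('n, complex^2) chart \<Rightarrow> 'm \<Rightarrow> complex^2 \<Rightarrow> complex)
     \<Rightarrow> (('n, complex^2) chart \<Rightarrow> 'm \<Rightarrow> complex^2 \<Rightarrow> complex) \<Rightarrow> bool" where
  "unitary_coframe_along M N x W \<omega>1 \<omega>2 \<longleftrightarrow>
     (\<forall>\<omega>\<in>{\<omega>1, \<omega>2}.
        (\<forall>l\<in>atlas N. \<forall>v. smooth_fn M {p \<in> W. x p \<in> fst l} (\<lambda>p. \<omega> l p v)) \<and>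
        (\<forall>p\<in>W. \<forall>l\<in>charts_at (atlas N) (x p).
           linear (\<omega> l p) \<and> (\<forall>v. \<omega> l p (Jmul v) = \<i> * \<omega> l p v) \<and>
           (\<forall>l'\<in>charts_at (atlas N) (x p). \<forall>v.
              \<omega> l p v = \<omega> l' p (coord_deriv l (snd l') (x p) v)))) \<and>
     (\<forall>p\<in>W. \<forall>l\<in>charts_at (atlas N) (x p). \<forall>v.
        metric N l (x p) v v = (cmod (\<omega>1 l p v))\<^sup>2 + (cmod (\<omega>2 l p v))\<^sup>2)"

text \<open>Here \<open>\<phi> = cos (\<alpha>/2) \<omega>\<^sub>1 + sin (\<alpha>/2) \<omega>\<^sub>2\<bar>\<close> restricted to the surface, and the metric is
  \<open>\<phi> \<phi>\<bar>\<close>. The complementary form \<open>\<nu> = sin (\<alpha>/2) \<omega>\<^sub>1 - cos (\<alpha>/2) \<omega>\<^sub>2\<bar>\<close> then vanishes on the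
  tangent planes, is isometric on the normal planes, and expresses how \<open>a\<close>, \<open>b\<close>, \<open>c\<close> determine
  the second fundamental form: \<open>\<nu>(II) = -(a \<phi>\<phi> + 2b \<phi>\<phi>\<bar> + c \<phi>\<bar>\<phi>\<bar>)\<close>. The requirement
  that the coefficient \<open>b\<close> be a positive constant fixes the phase of the coframe. With
  \<open>\<nabla>\<omega>\<^sub>i = - \<Sum>\<^sub>j \<omega>\<^sub>i\<^sub>j \<omega>\<^sub>j\<close>, the formula for \<open>\<nu>(II)\<close> says
  \<open>(d\<alpha> - sin \<alpha> (\<omega>\<^sub>1\<^sub>1 + \<omega>\<^sub>2\<^sub>2))/2 = a \<phi> + b \<phi>\<bar>\<close> and \<open>-\<omega>\<^sub>1\<^sub>2 = b \<phi> + c \<phi>\<bar>\<close>.\<close>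

definition adapted_coframe ::
    "('m, complex) riem \<Rightarrow> ('n, complex^2) riem \<Rightarrow> ('m \<Rightarrow> 'n) \<Rightarrow> real \<Rightarrow> ('m \<Rightarrow> real)
     \<Rightarrow> (('n, complex^2) chart \<Rightarrow> 'm \<Rightarrow> complex^2 \<Rightarrow> complex)
     \<Rightarrow> (('n, complex^2) chart \<Rightarrow> 'm \<Rightarrow> complex^2 \<Rightarrow> complex)
     \<Rightarrow> 'm form1 \<Rightarrow> ('m \<Rightarrow> complex) \<Rightarrow> ('m \<Rightarrow> complex) \<Rightarrow> bool" where
  "adapted_coframe M N x b \<alpha> \<omega>1 \<omega>2 \<phi> a c \<longleftrightarrow>
     unitary_coframe_along M N x (generic_part M \<alpha>) \<omega>1 \<omega>2 \<and>
     (\<forall>p\<in>generic_part M \<alpha>. \<forall>k\<in>charts_at (atlas M) p.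
        (\<forall>u v. metric M k p u v = Re (\<phi> k p u * cnj (\<phi> k p v))) \<and>
        (\<forall>l\<in>charts_at (atlas N) (x p). \<forall>u v.
           \<phi> k p u = cos (\<alpha> p / 2) * \<omega>1 l p (push x k l p u)
                   + sin (\<alpha> p / 2) * cnj (\<omega>2 l p (push x k l p u)) \<and>
           sin (\<alpha> p / 2) * \<omega>1 l p (second_fundamental_form M N x k l p u v)
           - cos (\<alpha> p / 2) * cnj (\<omega>2 l p (second_fundamental_form M N x k l p u v))
             = - (a p * \<phi> k p u * \<phi> k p v
                  + b * (\<phi> k p u * cnj (\<phi> k p v) + cnj (\<phi> k p u) * \<phi> k p v)
                  + c p * cnj (\<phi> k p u) * cnj (\<phi> k p v))))"

definition structure_equations ::
    "('m, complex) riem \<Rightarrow> real \<Rightarrow> real \<Rightarrow> ('m \<Rightarrow> real) \<Rightarrow> 'm form1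
     \<Rightarrow> ('m \<Rightarrow> complex) \<Rightarrow> ('m \<Rightarrow> complex) \<Rightarrow> bool" where
  "structure_equations M \<rho> b \<alpha> \<phi> a c \<longleftrightarrow>
     smooth_fn M (generic_part M \<alpha>) \<alpha> \<and> smooth_fn M (generic_part M \<alpha>) a \<and>
     smooth_fn M (generic_part M \<alpha>) c \<and>
     (\<forall>k\<in>atlas M. \<forall>u. smooth_in k (generic_part M \<alpha>) (\<lambda>p. \<phi> k p u)) \<and>
     (\<forall>p\<in>generic_part M \<alpha>. \<forall>k\<in>charts_at (atlas M) p.
        let \<theta> = \<phi> k p; \<theta>' = (\<lambda>u. cnj (\<phi> k p u)); s = sin (\<alpha> p); t = cos (\<alpha> p) in
        (\<forall>u. of_real (coord_deriv k \<alpha> p u) = (a p + b) * \<theta> u + (cnj (a p) + b) * \<theta>' u) \<and>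
        (\<forall>u v. ext_deriv \<phi> k p u v = (cnj (a p) - b) * cot (\<alpha> p) * wedge \<theta> \<theta>' u v) \<and>
        gauss_curvature M k p = - 4 * ((cmod (a p))\<^sup>2 - b\<^sup>2) + 6 * \<rho> * t\<^sup>2 \<and>
        (\<forall>u v. wedge (coord_deriv k a p) \<theta> u v =
           - (2 * a p * (cnj (a p) - b) * cot (\<alpha> p) + 3 / 2 * \<rho> * s * t) * wedge \<theta> \<theta>' u v) \<and>
        (\<forall>u v. wedge (coord_deriv k c p) \<theta>' u v =
           2 * c p * (a p - b) * cot (\<alpha> p) * wedge \<theta> \<theta>' u v) \<and>
        (cmod (c p))\<^sup>2 = (cmod (a p))\<^sup>2 + \<rho> / 2 * (- 2 + 3 * s\<^sup>2))"

definition general_type ::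
    "('m, complex) riem \<Rightarrow> ('m \<Rightarrow> real) \<Rightarrow> ('m \<Rightarrow> complex) \<Rightarrow> bool" where
  "general_type M \<alpha> a \<longleftrightarrow>
     (\<forall>p\<in>generic_part M \<alpha>. a p \<noteq> cnj (a p) \<and>
        (\<forall>k\<in>charts_at (atlas M) p. \<exists>u. coord_deriv k \<alpha> p u \<noteq> 0))"

definition locally_function_of ::
    "('m, complex) riem \<Rightarrow> ('m \<Rightarrow> real) \<Rightarrow> ('m \<Rightarrow> complex) \<Rightarrow> bool" where
  "locally_function_of M \<alpha> a \<longleftrightarrow>
     (\<forall>p\<in>generic_part M \<alpha>. \<exists>W f. openin (mtop M) W \<and> p \<in> W \<and> W \<subseteq> generic_part M \<alpha> \<and>
        (\<forall>q\<in>W. a q = f (\<alpha> q)))"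

text \<open>Complex coordinates of the Riemann surface structure for which \<open>\<phi>\<close> has type (1,0).\<close>

definition complex_coordinate ::
    "('m, complex) riem \<Rightarrow> ('m \<Rightarrow> real) \<Rightarrow> 'm form1 \<Rightarrow> 'm set \<Rightarrow> ('m \<Rightarrow> complex)
     \<Rightarrow> ('m \<Rightarrow> complex) \<Rightarrow> bool" where
  "complex_coordinate M \<alpha> \<phi> V z \<mu> \<longleftrightarrow>
     openin (mtop M) V \<and> V \<subseteq> generic_part M \<alpha> \<and> smooth_fn M V z \<and> open (z ` V) \<and>
     homeomorphic_map (subtopology (mtop M) V) (top_of_set (z ` V)) z \<and>
     (\<forall>p\<in>V. \<mu> p \<noteq> 0 \<and>
        (\<forall>k\<in>charts_at (atlas M) p. \<forall>u. \<phi> k p u = \<mu> p * coord_deriv k z p u))"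

end

theory Submission
  imports Defs "HOL-Complex_Analysis.Conformal_Mappings"
begin

text \<open>For an immersion of general type \<open>a\<close> is a function of \<open>\<alpha>\<close>, and \<open>\<alpha>\<close> satisfies
  \<open>\<partial>\<partial>\<bar>\<alpha> = F(\<alpha>) \<partial>\<alpha> \<partial>\<bar>\<alpha>\<close>. Therefore some function \<open>H(\<alpha>)\<close> of the Kaehler angle is harmonic: it
  suffices that \<open>h = H'\<close> solves \<open>h' = - F h\<close>, and a positive solution makes \<open>H\<close> injective. The new coordinate
  \<open>w\<close> is the holomorphic function with real part \<open>H(\<alpha>)\<close>. As \<open>d\<alpha> = 2 Re ((a + b) \<phi>)\<close>, its differential
  is \<open>dw = 2 h(\<alpha>) (a + b) \<phi>\<close>. Thus \<open>\<phi> = \<mu> dw\<close> with \<open>\<mu> = 1 / (2 h(\<alpha>) (a + b))\<close>, a function of \<open>\<alpha>\<close> and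
  hence of \<open>H(\<alpha>) = Re w\<close>.

  The proof works with this differential rather than with the second-order equation. If \<open>h\<close> solves
  \<open>h' = - F h\<close>, the structure equations say that the form \<open>2 h(\<alpha>) (a + b) \<phi>\<close> is closed, whatever
  chart is used to compute its exterior derivative. The Poincare lemma \<open>closed_form_exact_on_ball\<close>
  then provides a primitive \<open>W\<close>, with real part \<open>H(\<alpha>)\<close> up to a constant that can be absorbed into
  \<open>H\<close> (\<open>structure_equations_primitive\<close>). Since \<open>dW\<close> is a complex multiple of \<open>dz\<close>, the function \<open>W\<close>
  is holomorphic in \<open>z\<close> (\<open>has_field_derivative_through_coordinate\<close>); its derivative does not vanish, so
  it is locally a coordinate (\<open>complex_coordinate_holomorphic_change\<close>).

  One analytic point needs care: \<open>F\<close> must be continuous as a function of a real variable, while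
  \<open>a = f(\<alpha>)\<close> comes with no regularity of \<open>f\<close>. Because \<open>d\<alpha>\<close> has no zero, \<open>\<alpha>\<close> is an open map, and
  continuity descends along open maps (\<open>continuous_on_factor_through_open_map\<close>).\<close>

section \<open>Calculus of functions of class \<open>C\<^sup>k\<close>\<close>

text \<open>Openness matters: the derivative \<open>frechet_derivative f (at y)\<close> sees \<open>f\<close> on a full neighbourhood of \<open>y\<close>.\<close>

lemma Ck_on_cong:
  assumes "open S" "\<And>y. y \<in> S \<Longrightarrow> f y = g y" "Ck_on n S f"
  shows "Ck_on n S g"
  using assms
proof (induction n arbitrary: f g)
  case 0
  then show ?case by (metis Ck_on.simps(1) continuous_on_cong)
next
  case (Suc n)
  have df: "f differentiable (at y)" if "y \<in> S" for y
    using Suc.prems that by simp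
  have "g differentiable (at y)" if "y \<in> S" for y
    using df[OF that] Suc.prems(1,2) that unfolding differentiable_def
    by (metis has_derivative_transform_within_open)
  moreover have "Ck_on n S (\<lambda>y. frechet_derivative g (at y) v)" for v
  proof (rule Suc.IH[OF Suc.prems(1)])
    show "Ck_on n S (\<lambda>y. frechet_derivative f (at y) v)" using Suc.prems by simp
    show "frechet_derivative f (at y) v = frechet_derivative g (at y) v" if "y \<in> S" for y
      using frechet_derivative_transform_within_open[OF df[OF that] Suc.prems(1) that Suc.prems(2)]
      by simp
  qed
  ultimately show ?case by simp
qed

lemma Ck_on_subset: "Ck_on n S f \<Longrightarrow> T \<subseteq> S \<Longrightarrow> Ck_on n T f"
proof (induction n arbitrary: f)
  case 0
  then show ?case using continuous_on_subset by auto
qed auto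

lemma Ck_on_SucD: "Ck_on (Suc n) S f \<Longrightarrow> Ck_on n S f"
proof (induction n arbitrary: f)
  case 0
  then show ?case
    by (simp add: continuous_at_imp_continuous_on differentiable_imp_continuous_within)
next
  case (Suc n)
  show ?case
    unfolding Ck_on.simps(2)[of n]
  proof (intro conjI allI ballI)
    show "f differentiable (at y)" if "y \<in> S" for y using Suc.prems that by simp
    show "Ck_on n S (\<lambda>y. frechet_derivative f (at y) v)" for v
      by (rule Suc.IH) (use Suc.prems in \<open>simp only: Ck_on.simps(2)[of "Suc n"]\<close>)
  qed
qed

lemma Ck_on_add:
  assumes "open S" "Ck_on n S f" "Ck_on n S g"
  shows "Ck_on n S (\<lambda>y. f y + g y)"
  using assms(2,3)
proof (induction n arbitrary: f g)
  case 0
  then show ?case by (auto intro: continuous_on_add)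
next
  case (Suc n)
  show ?case
    unfolding Ck_on.simps(2)
  proof (intro conjI allI ballI)
    show "(\<lambda>y. f y + g y) differentiable (at y)" if "y \<in> S" for y
      using Suc.prems that by (auto intro: differentiable_add)
    show "Ck_on n S (\<lambda>y. frechet_derivative (\<lambda>y. f y + g y) (at y) v)" for v
    proof (rule Ck_on_cong[OF assms(1)])
      show "Ck_on n S (\<lambda>y. frechet_derivative f (at y) v + frechet_derivative g (at y) v)"
        using Suc by simp
      show "frechet_derivative f (at y) v + frechet_derivative g (at y) v
          = frechet_derivative (\<lambda>y. f y + g y) (at y) v" if "y \<in> S" for y
        using frechet_derivative_at[OF has_derivative_add[of f "frechet_derivative f (at y)" "at y" g
            "frechet_derivative g (at y)"]] Suc.prems that
        by (simp add: frechet_derivative_works fun_eq_iff)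
    qed
  qed
qed

lemma Ck_on_mult:
  fixes f g :: "'a::euclidean_space \<Rightarrow> 'b::real_normed_algebra"
  assumes "open S" "Ck_on n S f" "Ck_on n S g"
  shows "Ck_on n S (\<lambda>y. f y * g y)"
  using assms(2,3)
proof (induction n arbitrary: f g)
  case 0
  then show ?case by (auto intro: continuous_on_mult)
next
  case (Suc n)
  have D: "((\<lambda>y. f y * g y) has_derivative
      (\<lambda>v. f y * frechet_derivative g (at y) v + frechet_derivative f (at y) v * g y)) (at y)"
    if "y \<in> S" for y
    using Suc.prems that by (intro has_derivative_mult) (auto simp: frechet_derivative_works)
  show ?case
    unfolding Ck_on.simps(2)
  proof (intro conjI allI ballI)
    show "(\<lambda>y. f y * g y) differentiable (at y)" if "y \<in> S" for y
      using D[OF that] by (rule differentiableI)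
    show "Ck_on n S (\<lambda>y. frechet_derivative (\<lambda>y. f y * g y) (at y) v)" for v
    proof (rule Ck_on_cong[OF assms(1)])
      show "Ck_on n S (\<lambda>y. f y * frechet_derivative g (at y) v + frechet_derivative f (at y) v * g y)"
        using Ck_on_SucD[OF Suc.prems(1)] Ck_on_SucD[OF Suc.prems(2)] Suc.prems
        by (intro Ck_on_add assms(1) Suc.IH) simp_all
      show "f y * frechet_derivative g (at y) v + frechet_derivative f (at y) v * g y
          = frechet_derivative (\<lambda>y. f y * g y) (at y) v" if "y \<in> S" for y
        using frechet_derivative_at[OF D[OF that]] by metis
    qed
  qed
qed

lemma holomorphic_compose_has_derivative:
  assumes "w holomorphic_on T" "open T" "g y \<in> T" "g differentiable (at y)"
  shows "((\<lambda>y. w (g y)) has_derivative (\<lambda>v. deriv w (g y) * frechet_derivative g (at y) v)) (at y)"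
proof -
  have "(w has_field_derivative deriv w (g y)) (at (g y))"
    using assms by (meson holomorphic_derivI)
  then show ?thesis
    using has_derivative_compose[of g _ y UNIV w "(*) (deriv w (g y))"] assms(4)
    by (simp add: has_field_derivative_def frechet_derivative_works)
qed

text \<open>By the chain rule, \<open>d(w \<circ> g) = (w' \<circ> g) dg\<close>; since \<open>w'\<close> is again holomorphic, the
  induction can be run over all holomorphic \<open>w\<close> simultaneously.\<close>

lemma Ck_on_holomorphic_compose:
  assumes "open S" "open T" "g ` S \<subseteq> T" "w holomorphic_on T" "Ck_on n S g"
  shows "Ck_on n S (\<lambda>y. w (g y))"
  using assms(4,5)
proof (induction n arbitrary: w)
  case 0
  then show ?case
    using assms(3) by (auto intro: continuous_on_compose2[of T w S g] holomorphic_on_imp_continuous_on)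
next
  case (Suc n)
  have D: "((\<lambda>y. w (g y)) has_derivative (\<lambda>v. deriv w (g y) * frechet_derivative g (at y) v)) (at y)"
    if "y \<in> S" for y
    using Suc.prems assms that by (intro holomorphic_compose_has_derivative[where T=T]) auto
  show ?case
    unfolding Ck_on.simps(2)
  proof (intro conjI allI ballI)
    show "(\<lambda>y. w (g y)) differentiable (at y)" if "y \<in> S" for y
      using D[OF that] by (rule differentiableI)
    show "Ck_on n S (\<lambda>y. frechet_derivative (\<lambda>y. w (g y)) (at y) v)" for v
    proof (rule Ck_on_cong[OF assms(1)])
      show "Ck_on n S (\<lambda>y. deriv w (g y) * frechet_derivative g (at y) v)"
        using Suc.prems(2)
        by (intro Ck_on_mult[OF assms(1)] Suc.IH[OF holomorphic_deriv[OF Suc.prems(1) assms(2)]]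
              Ck_on_SucD[OF Suc.prems(2)]) simp
      show "deriv w (g y) * frechet_derivative g (at y) v
          = frechet_derivative (\<lambda>y. w (g y)) (at y) v" if "y \<in> S" for y
        using frechet_derivative_at[OF D[OF that]] by metis
    qed
  qed
qed

lemma smooth_on_has_derivative:
  "smooth_on S f \<Longrightarrow> y \<in> S \<Longrightarrow> (f has_derivative frechet_derivative f (at y)) (at y)"
  unfolding smooth_on_def by (metis Ck_on.simps(2) frechet_derivative_works)

lemma smooth_on_continuous: "smooth_on S f \<Longrightarrow> continuous_on S f"
  unfolding smooth_on_def by (metis Ck_on.simps(1))

lemma smooth_on_continuous_derivative:
  "smooth_on S f \<Longrightarrow> continuous_on S (\<lambda>y. frechet_derivative f (at y) v)"
  unfolding smooth_on_def by (metis Ck_on.simps)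

lemma smooth_on_subset: "smooth_on S f \<Longrightarrow> T \<subseteq> S \<Longrightarrow> smooth_on T f"
  unfolding smooth_on_def using Ck_on_subset by blast

section \<open>Closed one-forms and open maps\<close>

text \<open>The Poincare lemma in degree one for \<open>C\<^sup>1\<close> forms. The primitive is the integral of \<open>\<omega>\<close> along rays,
  \<open>W(y) = \<integral>\<^sub>0\<^sup>1 \<omega>(p + t(y - p))(y - p) dt\<close>. Differentiating under the integral in the direction \<open>v\<close>
  gives the integrand \<open>t (D\<^sub>v \<omega>)(y - p) + \<omega>(v)\<close>; closedness exchanges the arguments \<open>v\<close> and \<open>y - p\<close>,
  which turns it into the total derivative \<open>d/dt (t \<omega>(v))\<close>.\<close>

lemma closed_form_exact_on_ball:
  fixes \<omega> :: "'a::euclidean_space \<Rightarrow> 'a \<Rightarrow> 'b::banach"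
  assumes lin: "\<And>y. y \<in> ball p r \<Longrightarrow> linear (\<omega> y)"
    and deriv: "\<And>y u. y \<in> ball p r \<Longrightarrow> ((\<lambda>y. \<omega> y u) has_derivative (\<lambda>v. D y v u)) (at y)"
    and cont: "\<And>u v. continuous_on (ball p r) (\<lambda>y. D y v u)"
    and closed: "\<And>y u v. y \<in> ball p r \<Longrightarrow> D y u v = D y v u"
  obtains W where "\<And>y. y \<in> ball p r \<Longrightarrow> (W has_derivative \<omega> y) (at y)"
proof -
  define B where "B = ball p r"
  define c where "c y t = p + t *\<^sub>R (y - p)" for y :: 'a and t :: real
  have c_in: "c y t \<in> B" if "y \<in> B" "t \<in> {0..1}" for y t
  proof -
    have "norm (t *\<^sub>R (y - p)) \<le> norm (y - p)"
      using that(2) by (simp add: mult_left_le_one_le)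
    then show ?thesis
      using that(1) by (simp add: B_def c_def dist_norm norm_minus_commute)
  qed
  \<comment> \<open>Expanding in a basis reduces the derivative of \<open>y \<mapsto> \<omega> (c y t) (y - p)\<close>, in which \<open>y\<close> occurs
    twice, to the product rule.\<close>
  have exp1: "\<omega> y u = (\<Sum>i\<in>Basis. (u \<bullet> i) *\<^sub>R \<omega> y i)" if "y \<in> B" for y u
  proof -
    interpret linear "\<omega> y" using lin that B_def by auto
    show ?thesis
      by (subst euclidean_representation[symmetric, of u]) (simp add: sum scale)
  qed
  have cont_\<omega>: "continuous_on B (\<lambda>y. \<omega> y u)" for u
    using deriv by (auto simp: B_def intro!: continuous_at_imp_continuous_on has_derivative_continuous)
  define f where "f y t = (\<Sum>i\<in>Basis. ((y - p) \<bullet> i) *\<^sub>R \<omega> (c y t) i)" for y t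
  have linD: "linear (\<lambda>v. D y v u)" if "y \<in> B" for y u
    using deriv[of y u] that B_def has_derivative_linear by blast
  define f' where "f' y t = (\<lambda>v. \<Sum>i\<in>Basis. ((y - p) \<bullet> i) *\<^sub>R (t *\<^sub>R D (c y t) v i)
                         + (v \<bullet> i) *\<^sub>R \<omega> (c y t) i)" for y t
  have df: "((\<lambda>y. f y t) has_derivative f' y t) (at y)" if "y \<in> B" "t \<in> {0..1}" for y t
  proof -
    have cd: "((\<lambda>y. c y t) has_derivative (\<lambda>v. t *\<^sub>R v)) (at y)"
      unfolding c_def by (auto intro!: derivative_eq_intros)
    have "((\<lambda>y. \<omega> (c y t) i) has_derivative (\<lambda>v. t *\<^sub>R D (c y t) v i)) (at y)" for i
      using has_derivative_compose[OF cd, of "\<lambda>y. \<omega> y i" "\<lambda>v. D (c y t) v i"]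
        deriv[of "c y t" i] c_in[OF that] linear_scale[OF linD[OF c_in[OF that]]]
      by (simp add: B_def)
    then show ?thesis
      unfolding f_def f'_def
      by (auto intro!: derivative_eq_intros)
  qed
  have bl: "bounded_linear (f' y t)" if "y \<in> B" "t \<in> {0..1}" for y t
    using df[OF that] has_derivative_bounded_linear by blast
  define fb where "fb y t = Blinfun (f' y t)" for y t
  have fb: "blinfun_apply (fb y t) = f' y t" if "y \<in> B" "t \<in> {0..1}" for y t
    unfolding fb_def using bl[OF that] by (simp add: bounded_linear_Blinfun_apply)
  have c_cont: "continuous_on (B \<times> {0..1}) (\<lambda>x. c (fst x) (snd x))"
    unfolding c_def by (intro continuous_intros)
  have cc: "continuous_on (B \<times> {0..1}) (\<lambda>x. g (c (fst x) (snd x)))"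
    if "continuous_on B g" for g :: "'a \<Rightarrow> 'b"
    by (rule continuous_on_compose2[OF that c_cont]) (auto intro: c_in)
  have cont_D: "continuous_on B (\<lambda>y. D y v u)" for u v
    using cont by (simp add: B_def)
  have cont_f': "continuous_on (B \<times> {0..1}) (\<lambda>x. f' (fst x) (snd x) v)" for v
    unfolding f'_def by (intro continuous_intros cc cont_\<omega> cont_D)
  have cont_f: "continuous_on (B \<times> {0..1}) (\<lambda>x. f (fst x) (snd x))"
    unfolding f_def by (intro continuous_intros cc cont_\<omega>)
  have cont_f1: "continuous_on {0..1} (f y)" if "y \<in> B" for y
    using that by (intro continuous_on_compose2[OF cont_f, of _ "\<lambda>t. (y, t)", simplified])
      (auto intro!: continuous_intros)
  have cont_f'1: "continuous_on {0..1} (\<lambda>t. f' y t v)" if "y \<in> B" for y v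
    using that by (intro continuous_on_compose2[OF cont_f', of _ "\<lambda>t. (y, t)", simplified])
      (auto intro!: continuous_intros)
  have cont_fb: "continuous_on (B \<times> cbox 0 1) (\<lambda>(y, t). fb y t)"
  proof (rule continuous_on_blinfun_componentwise)
    fix i :: 'a
    show "continuous_on (B \<times> cbox 0 1) (\<lambda>x. blinfun_apply (case x of (y, t) \<Rightarrow> fb y t) i)"
      using cont_f'[of i] unfolding cbox_interval by (rule continuous_on_eq) (auto simp: fb)
  qed
  define W where "W y = integral {0..1} (f y)" for y
  have "(W has_derivative \<omega> y) (at y)" if y: "y \<in> B" for y
  proof -
    have "((\<lambda>x. integral (cbox 0 1) (f x)) has_derivative integral (cbox 0 1) (fb y)) (at y within B)"
    proof (rule leibniz_rule[OF _ _ cont_fb y])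
      show "((\<lambda>x. f x t) has_derivative blinfun_apply (fb x t)) (at x within B)"
        if "x \<in> B" "t \<in> cbox 0 1" for x t
        using df[of x t] fb[of x t] that by (auto intro: has_derivative_at_withinI)
      show "f x integrable_on cbox 0 1" if "x \<in> B" for x
        using cont_f1[OF that] by (simp add: integrable_continuous_interval)
      show "convex B" by (simp add: B_def)
    qed
    then have W': "(W has_derivative integral (cbox 0 1) (fb y)) (at y)"
      using at_within_open[of y B] y by (simp add: W_def[abs_def] B_def)
    have "blinfun_apply (integral (cbox 0 1) (fb y)) v = \<omega> y v" for v
    proof -
      have fbi: "fb y integrable_on cbox 0 1"
      proof (rule integrable_continuous)
        show "continuous_on (cbox 0 1) (fb y)"
          using y by (intro continuous_on_compose2[OF cont_fb, of _ "\<lambda>t. (y, t)", simplified])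
            (auto intro!: continuous_intros)
      qed
      have "blinfun_apply (integral (cbox 0 1) (fb y)) v = integral {0..1} (\<lambda>t. f' y t v)"
        unfolding blinfun_apply_integral[OF fbi] unfolding cbox_interval
        by (rule integral_cong) (use y in \<open>auto simp: fb\<close>)
      moreover have "((\<lambda>t. f' y t v) has_integral (1 *\<^sub>R \<omega> (c y 1) v - 0 *\<^sub>R \<omega> (c y 0) v)) {0..1}"
      proof (rule fundamental_theorem_of_calculus)
        fix t :: real assume t: "t \<in> {0..1}"
        note cB = c_in[OF y t]
        have "((\<lambda>t. c y t) has_derivative (\<lambda>h. h *\<^sub>R (y - p))) (at t)"
          unfolding c_def by (auto intro!: derivative_eq_intros)
        from has_derivative_compose[OF this, of "\<lambda>y. \<omega> y v" "\<lambda>w. D (c y t) w v"]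
        have "((\<lambda>t. \<omega> (c y t) v) has_derivative (\<lambda>h. h *\<^sub>R D (c y t) (y - p) v)) (at t)"
          using deriv[of "c y t" v] cB linear_scale[OF linD[OF cB]] by (simp add: B_def)
        then have "((\<lambda>t. t *\<^sub>R \<omega> (c y t) v) has_vector_derivative
            (t *\<^sub>R D (c y t) (y - p) v + \<omega> (c y t) v)) (at t)"
          unfolding has_vector_derivative_def
          by (auto intro!: derivative_eq_intros simp: algebra_simps)
        moreover have "D (c y t) (y - p) v = (\<Sum>i\<in>Basis. ((y - p) \<bullet> i) *\<^sub>R D (c y t) v i)"
        proof -
          interpret linear "\<lambda>w. D (c y t) w v" by (rule linD[OF cB])
          have "D (c y t) (y - p) v = D (c y t) (\<Sum>i\<in>Basis. ((y - p) \<bullet> i) *\<^sub>R i) v"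
            by (simp only: euclidean_representation)
          also have "\<dots> = (\<Sum>i\<in>Basis. ((y - p) \<bullet> i) *\<^sub>R D (c y t) i v)"
            by (simp only: sum scale)
          also have "\<dots> = (\<Sum>i\<in>Basis. ((y - p) \<bullet> i) *\<^sub>R D (c y t) v i)"
            using closed cB by (simp add: B_def)
          finally show ?thesis .
        qed
        then have "f' y t v = t *\<^sub>R D (c y t) (y - p) v + \<omega> (c y t) v"
          by (simp only: f'_def exp1[OF cB, of v] sum.distrib scaleR_sum_right scaleR_scaleR
              mult.commute)
        ultimately have "((\<lambda>t. t *\<^sub>R \<omega> (c y t) v) has_vector_derivative f' y t v) (at t)"
          by simp
        then show "((\<lambda>t. t *\<^sub>R \<omega> (c y t) v) has_vector_derivative f' y t v) (at t within {0..1})"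
          by (rule has_vector_derivative_at_within)
      qed simp
      ultimately show ?thesis by (simp add: c_def integral_unique)
    qed
    then show ?thesis using W' by presburger
  qed
  then show ?thesis using that B_def by blast
qed

text \<open>Along a line on which the derivative does not vanish, \<open>A\<close> takes both smaller and larger values
  arbitrarily close to \<open>y\<close>; as balls are connected, it takes all values in between.\<close>

lemma open_map_on_of_nonzero_derivative:
  fixes A :: "'a::real_normed_vector \<Rightarrow> real"
  assumes "open S" and deriv: "\<And>y. y \<in> S \<Longrightarrow> (A has_derivative A' y) (at y)"
    and nz: "\<And>y. y \<in> S \<Longrightarrow> \<exists>u. A' y u \<noteq> 0"
  shows "open (A ` S)"
proof (rule openI)
  fix s assume "s \<in> A ` S"
  then obtain y where y: "y \<in> S" "s = A y" by blast
  obtain r where r: "r > 0" "ball y r \<subseteq> S" using assms(1) y by (meson openE)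
  obtain u where u: "A' y u \<noteq> 0" using nz y by blast
  have D: "((\<lambda>t. A (y + t *\<^sub>R u)) has_real_derivative A' y u) (at 0)"
  proof -
    have "((\<lambda>t. y + t *\<^sub>R u) has_derivative (\<lambda>t. t *\<^sub>R u)) (at 0)"
      by (auto intro!: derivative_eq_intros)
    from has_derivative_compose[OF this, of A "A' y"]
    show ?thesis
      using deriv[OF y(1)] linear_scale[OF has_derivative_linear[OF deriv[OF y(1)]]]
      by (simp add: has_field_derivative_def mult_commute_abs)
  qed
  have inS: "y + t *\<^sub>R u \<in> ball y r" if "\<bar>t\<bar> < r / (norm u + 1)" for t
  proof -
    have "\<bar>t\<bar> * norm u \<le> \<bar>t\<bar> * (norm u + 1)" by (simp add: mult_left_mono)
    also have "\<dots> < r"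
      using that by (simp add: pos_less_divide_eq add_pos_nonneg add.commute)
    finally show ?thesis by (simp add: dist_norm)
  qed
  define e where "e = r / (norm u + 1)"
  have e: "e > 0" using r by (simp add: e_def add_pos_nonneg add.commute)
  obtain t1 t2 where t: "\<bar>t1\<bar> < e" "\<bar>t2\<bar> < e"
    "A (y + t1 *\<^sub>R u) < A y" "A y < A (y + t2 *\<^sub>R u)"
  proof (cases "A' y u > 0")
    case True
    obtain d where d: "d > 0" "\<And>h. 0 < h \<Longrightarrow> h < d \<Longrightarrow> A y < A (y + h *\<^sub>R u)"
      using DERIV_pos_inc_right[OF D True] by auto
    obtain d' where d': "d' > 0" "\<And>h. 0 < h \<Longrightarrow> h < d' \<Longrightarrow> A (y + (- h) *\<^sub>R u) < A y"
      using DERIV_pos_inc_left[OF D True] by auto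
    show ?thesis
      by (rule that[of "- (min d' e / 2)" "min d e / 2"])
        (use d(1) d'(1) e d(2)[of "min d e / 2"] d'(2)[of "min d' e / 2"] in auto)
  next
    case False
    then have neg: "A' y u < 0" using u by simp
    obtain d where d: "d > 0" "\<And>h. 0 < h \<Longrightarrow> h < d \<Longrightarrow> A (y + h *\<^sub>R u) < A y"
      using DERIV_neg_dec_right[OF D neg] by auto
    obtain d' where d': "d' > 0" "\<And>h. 0 < h \<Longrightarrow> h < d' \<Longrightarrow> A y < A (y + (- h) *\<^sub>R u)"
      using DERIV_neg_dec_left[OF D neg] by auto
    show ?thesis
      by (rule that[of "min d e / 2" "- (min d' e / 2)"])
        (use d(1) d'(1) e d(2)[of "min d e / 2"] d'(2)[of "min d' e / 2"] in auto)
  qed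
  have "connected (A ` ball y r)"
    using r deriv by (intro connected_continuous_image continuous_at_imp_continuous_on)
      (auto intro: has_derivative_continuous)
  then have "{A (y + t1 *\<^sub>R u)..A (y + t2 *\<^sub>R u)} \<subseteq> A ` ball y r"
    using t inS unfolding e_def by (intro connected_contains_Icc) auto
  then have "{A (y + t1 *\<^sub>R u)<..<A (y + t2 *\<^sub>R u)} \<subseteq> A ` S"
    using r(2) by (meson greaterThanLessThan_subseteq_atLeastAtMost_iff image_mono order_refl order_trans)
  moreover have "s \<in> {A (y + t1 *\<^sub>R u)<..<A (y + t2 *\<^sub>R u)}" using t y by simp
  ultimately show "\<exists>e>0. ball s e \<subseteq> A ` S"
    by (meson open_greaterThanLessThan openE order_trans)
qed

text \<open>An open map is a quotient map onto its image, so a function that is continuous on the source and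
  constant on the fibres descends to a continuous function. For the Kaehler angle this is what makes
  the coefficient \<open>F(\<alpha>)\<close> a continuous function of the real variable \<open>\<alpha>\<close>, although nothing is
  assumed about the regularity of the function expressing \<open>a\<close> through \<open>\<alpha>\<close>.\<close>

lemma continuous_on_factor_through_open_map:
  fixes A :: "'a::topological_space \<Rightarrow> 'b::topological_space" and E :: "'a \<Rightarrow> 'c::topological_space"
  assumes opn: "\<And>U. open U \<Longrightarrow> U \<subseteq> S \<Longrightarrow> open (A ` U)"
    and "open S" "continuous_on S E" and E: "\<And>y. y \<in> S \<Longrightarrow> E y = F (A y)"
  shows "continuous_on (A ` S) F"
  unfolding continuous_on_open_vimage[OF opn[OF assms(2) order_refl]]
proof (intro allI impI)
  fix B :: "'c set" assume "open B"
  then have "open (E -` B \<inter> S)"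
    using assms(2,3) continuous_on_open_vimage by blast
  then have "open (A ` (E -` B \<inter> S))" using opn by blast
  moreover have "A ` (E -` B \<inter> S) = F -` B \<inter> A ` S" using E by auto
  ultimately show "open (F -` B \<inter> A ` S)" by simp
qed

section \<open>The primitive determined by the structure equations\<close>

text \<open>The solution is \<open>h = exp (- \<integral> F)\<close>. Being positive, it has a strictly increasing primitive \<open>H\<close>.\<close>

lemma linear_ode_solution_on_ball:
  fixes F :: "real \<Rightarrow> real"
  assumes "open T" "s0 \<in> T" "continuous_on T F"
  obtains e h H where "e > 0" "ball s0 e \<subseteq> T"
    "\<And>s. s \<in> ball s0 e \<Longrightarrow> (h has_real_derivative - F s * h s) (at s)"
    "\<And>s. s \<in> ball s0 e \<Longrightarrow> (H has_real_derivative h s) (at s)"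
    "\<And>s. h s > 0" "inj_on H (ball s0 e)"
proof -
  obtain e where e: "e > 0" "cball s0 e \<subseteq> T" using assms by (meson open_contains_cball)
  have prim: "\<exists>g. \<forall>s\<in>ball s0 d. (g has_real_derivative f s) (at s)"
    if ctf: "continuous_on (cball s0 d) f" for f :: "real \<Rightarrow> real" and d
  proof -
    have I: "cball s0 d = {s0 - d..s0 + d}" by (auto simp: dist_real_def)
    obtain g where "\<And>s. s \<in> cball s0 d \<Longrightarrow> (g has_vector_derivative f s) (at s within cball s0 d)"
      using antiderivative_continuous[OF ctf[unfolded I]] unfolding I by blast
    then have "(g has_vector_derivative f s) (at s)" if "s \<in> ball s0 d" for s
      using that at_within_interior[of s "cball s0 d"]
      by (metis ball_subset_cball interior_cball subsetD)
    then show ?thesis unfolding has_real_derivative_iff_has_vector_derivative by blast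
  qed
  have cF: "continuous_on (cball s0 e) (\<lambda>s. - F s)"
    using assms(3) e(2) by (intro continuous_on_minus) (metis continuous_on_subset)
  obtain G where G: "\<And>s. s \<in> ball s0 e \<Longrightarrow> (G has_real_derivative - F s) (at s)"
    using prim[OF cF] by blast
  define h where "h s = exp (G s)" for s
  have h: "(h has_real_derivative - F s * h s) (at s)" if "s \<in> ball s0 e" for s
    unfolding h_def by (rule derivative_eq_intros G[OF that] refl)+ simp
  have sub: "cball s0 (e/2) \<subseteq> ball s0 e" using e(1) by auto
  have "continuous_on (cball s0 (e/2)) h"
    using h sub by (intro continuous_at_imp_continuous_on) (meson DERIV_isCont subsetD)
  then obtain H where H: "\<And>s. s \<in> ball s0 (e/2) \<Longrightarrow> (H has_real_derivative h s) (at s)"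
    using prim by blast
  have less: "H s < H t" if "s \<in> ball s0 (e/2)" "t \<in> ball s0 (e/2)" "s < t" for s t
  proof (rule DERIV_pos_imp_increasing[OF that(3)])
    fix x assume x: "s \<le> x" "x \<le> t"
    then have "x \<in> ball s0 (e/2)" using that unfolding mem_ball dist_real_def by linarith
    then show "\<exists>y. (H has_real_derivative y) (at x) \<and> 0 < y"
      using H by (metis h_def exp_gt_zero)
  qed
  have "inj_on H (ball s0 (e/2))"
    unfolding inj_on_def by (metis less less_irrefl linorder_neqE_linordered_idom)
  moreover have "ball s0 (e/2) \<subseteq> ball s0 e" using e(1) by auto
  moreover have "ball s0 (e/2) \<subseteq> T" using e calculation ball_subset_cball by blast
  ultimately show thesis using h H e(1)
    by (intro that[of "e/2" h H]) (auto simp: h_def)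
qed

text \<open>The heart of the argument, written in one coordinate patch: \<open>A\<close> is the Kaehler angle. By the
  structure equations,
  \<open>d(h(A) (a + b) \<phi>) = - (h'(A) |a + b|\<^sup>2 + h(A) (|a - b|\<^sup>2 cot A + 3\<rho>/2 sin A cos A)) \<phi> \<and> \<phi>\<bar>\<close>,
  which vanishes precisely when \<open>h' = - F h\<close> with the \<open>F\<close> of the equation
  \<open>\<partial>\<partial>\<bar>\<alpha> = F(\<alpha>) \<partial>\<alpha> \<partial>\<bar>\<alpha>\<close>. For such an \<open>h\<close> the form \<open>2 h(A) (a + b) \<phi>\<close> has a primitive \<open>W\<close>.
  Its real part is \<open>h(A) dA = dH(A)\<close>, because \<open>dA = 2 Re ((a + b) \<phi>)\<close>.\<close>

lemma structure_equations_primitive: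
  fixes A :: "complex \<Rightarrow> real" and a :: "complex \<Rightarrow> complex" and \<Phi> :: "complex \<Rightarrow> complex \<Rightarrow> complex"
    and b \<rho> :: real
  assumes S: "open S" "y0 \<in> S"
    and smooth: "smooth_on S A" "smooth_on S a" "\<And>u. smooth_on S (\<lambda>y. \<Phi> y u)"
    and lin: "\<And>y. y \<in> S \<Longrightarrow> linear (\<Phi> y)"
    and nz: "\<And>y. y \<in> S \<Longrightarrow> \<exists>u. frechet_derivative A (at y) u \<noteq> 0"
    and sin_nz: "\<And>y. y \<in> S \<Longrightarrow> sin (A y) \<noteq> 0"
    and ab_nz: "\<And>y. y \<in> S \<Longrightarrow> a y + of_real b \<noteq> 0"
    and af: "\<And>y. y \<in> S \<Longrightarrow> a y = f (A y)"
    and dA: "\<And>y u. y \<in> S \<Longrightarrow> of_real (frechet_derivative A (at y) u)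
        = (a y + of_real b) * \<Phi> y u + (cnj (a y) + of_real b) * cnj (\<Phi> y u)"
    and d\<Phi>: "\<And>y u v. y \<in> S \<Longrightarrow>
        frechet_derivative (\<lambda>y. \<Phi> y v) (at y) u - frechet_derivative (\<lambda>y. \<Phi> y u) (at y) v
        = (cnj (a y) - of_real b) * of_real (cot (A y)) * wedge (\<Phi> y) (\<lambda>u. cnj (\<Phi> y u)) u v"
    and da: "\<And>y u v. y \<in> S \<Longrightarrow> wedge (frechet_derivative a (at y)) (\<Phi> y) u v
        = - (2 * a y * (cnj (a y) - of_real b) * of_real (cot (A y))
             + 3 / 2 * of_real \<rho> * of_real (sin (A y)) * of_real (cos (A y)))
          * wedge (\<Phi> y) (\<lambda>u. cnj (\<Phi> y u)) u v"
  obtains r W h H where "r > 0" "ball y0 r \<subseteq> S"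
    "\<And>y. y \<in> ball y0 r \<Longrightarrow>
       (W has_derivative (\<lambda>u. 2 * of_real (h (A y)) * (a y + of_real b) * \<Phi> y u)) (at y)"
    "\<And>s. h s > (0::real)"
    "\<And>y. y \<in> ball y0 r \<Longrightarrow> Re (W y) = H (A y)" "inj_on H (A ` ball y0 r)"
proof -
  define A' where "A' y = frechet_derivative A (at y)" for y
  define a' where "a' y = frechet_derivative a (at y)" for y
  define \<Phi>' where "\<Phi>' y v u = frechet_derivative (\<lambda>y. \<Phi> y u) (at y) v" for y v u
  have A': "(A has_derivative A' y) (at y)" if "y \<in> S" for y
    unfolding A'_def using smooth_on_has_derivative smooth(1) that by blast
  have a': "(a has_derivative a' y) (at y)" if "y \<in> S" for y
    unfolding a'_def using smooth_on_has_derivative smooth(2) that by blast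
  have \<Phi>': "((\<lambda>y. \<Phi> y u) has_derivative (\<lambda>v. \<Phi>' y v u)) (at y)" if "y \<in> S" for y u
    unfolding \<Phi>'_def using smooth_on_has_derivative[OF smooth(3) that] by simp
  have contA: "continuous_on S A" and conta: "continuous_on S a"
    and cont\<Phi>: "continuous_on S (\<lambda>y. \<Phi> y u)" for u
    using smooth smooth_on_continuous by auto
  have contA': "continuous_on S (\<lambda>y. A' y v)" and conta': "continuous_on S (\<lambda>y. a' y v)"
    and cont\<Phi>': "continuous_on S (\<lambda>y. \<Phi>' y v u)" for u v
    unfolding A'_def a'_def \<Phi>'_def using smooth by (auto intro: smooth_on_continuous_derivative)
  have opn: "open (A ` U)" if "open U" "U \<subseteq> S" for U
    using that A' nz by (intro open_map_on_of_nonzero_derivative[of U A A']) (auto simp: A'_def)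
  \<comment> \<open>\<open>E\<close> is \<open>F(A)\<close> on the surface; \<open>F\<close> inherits continuity from it because \<open>A\<close> is open.\<close>
  define F where "F s = cot s * ((cmod (f s - b))\<^sup>2 + 3/2 * \<rho> * (sin s)\<^sup>2) / (cmod (f s + b))\<^sup>2" for s
  define E where "E y = cot (A y) * ((cmod (a y - b))\<^sup>2 + 3/2 * \<rho> * (sin (A y))\<^sup>2) / (cmod (a y + b))\<^sup>2" for y
  have "continuous_on S E"
    unfolding E_def cot_def using sin_nz ab_nz
    by (intro continuous_intros contA conta) auto
  moreover have EF: "E y = F (A y)" if "y \<in> S" for y
    using af[OF that] by (simp add: E_def F_def)
  ultimately have "continuous_on (A ` S) F"
    using opn S(1) by (intro continuous_on_factor_through_open_map[of S A E]) auto
  then obtain e h H where e: "e > 0" "ball (A y0) e \<subseteq> A ` S"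
    and h: "\<And>s. s \<in> ball (A y0) e \<Longrightarrow> (h has_real_derivative - F s * h s) (at s)"
    and H: "\<And>s. s \<in> ball (A y0) e \<Longrightarrow> (H has_real_derivative h s) (at s)"
    and hpos: "\<And>s. h s > 0" and injH: "inj_on H (ball (A y0) e)"
    using linear_ode_solution_on_ball[OF opn[OF S(1) order_refl], of "A y0" F] S(2) by blast
  have "open (A -` ball (A y0) e \<inter> S)"
    using contA S(1) continuous_on_open_vimage by blast
  moreover have "y0 \<in> A -` ball (A y0) e \<inter> S" using e S(2) by simp
  ultimately obtain r where r: "r > 0" "ball y0 r \<subseteq> A -` ball (A y0) e \<inter> S"
    by (meson openE)
  define B where "B = ball y0 r"
  have BS: "y \<in> S" and BA: "A y \<in> ball (A y0) e" if "y \<in> B" for y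
    using r that by (auto simp: B_def)
  \<comment> \<open>\<open>D\<close> is given by the product rule, with \<open>h' = - F h\<close> inserted in the first summand.\<close>
  define \<omega> where "\<omega> y u = 2 * of_real (h (A y)) * (a y + of_real b) * \<Phi> y u" for y u
  define D where "D y v u = 2 * (of_real (- E y * h (A y) * A' y v) * (a y + of_real b) * \<Phi> y u
      + of_real (h (A y)) * a' y v * \<Phi> y u
      + of_real (h (A y)) * (a y + of_real b) * \<Phi>' y v u)" for y v u
  have hA: "((\<lambda>y. h (A y)) has_derivative (\<lambda>v. - E y * h (A y) * A' y v)) (at y)" if "y \<in> B" for y
    using has_derivative_compose[OF A'[OF BS[OF that]], of h "(*) (- F (A y) * h (A y))"]
      h[OF BA[OF that]] EF[OF BS[OF that]] by (simp add: has_field_derivative_def)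
  have D\<omega>: "((\<lambda>y. \<omega> y u) has_derivative (\<lambda>v. D y v u)) (at y)" if "y \<in> B" for y u
    unfolding \<omega>_def D_def
    by (rule derivative_eq_intros hA[OF that] a'[OF BS[OF that]] \<Phi>'[OF BS[OF that]] refl)+
      (simp add: algebra_simps fun_eq_iff)
  have contB: "continuous_on B g" if "continuous_on S g" for g :: "complex \<Rightarrow> 'z::topological_space"
    using that BS continuous_on_subset by blast
  have conth: "continuous_on B (\<lambda>y. h (A y))"
    using hA by (intro continuous_at_imp_continuous_on) (meson has_derivative_continuous)
  have contD: "continuous_on B (\<lambda>y. D y v u)" for u v
    unfolding D_def
    by (intro continuous_intros conth contB[OF contA'] contB[OF conta'] contB[OF cont\<Phi>']
        contB[OF cont\<Phi>] contB[OF conta] contB[OF \<open>continuous_on S E\<close>])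
  have closed: "D y u v = D y v u" if y: "y \<in> B" for y u v
  proof -
    note yS = BS[OF y]
    \<comment> \<open>Here \<open>d\<omega>(u,v) = D y u v - D y v u\<close> is a multiple of \<open>w = (\<phi> \<and> \<phi>\<bar>)(u,v)\<close>, the facts 1, 2, 3
      being the contributions of \<open>dA \<and> \<phi>\<close>, \<open>da \<and> \<phi>\<close> and \<open>d\<phi>\<close>.\<close>
    define k s t hh where "k = complex_of_real (cot (A y))" and "s = complex_of_real (sin (A y))"
      and "t = complex_of_real (cos (A y))" and "hh = complex_of_real (h (A y))"
    have ks: "k * s\<^sup>2 = s * t"
    proof -
      have "cot (A y) * (sin (A y))\<^sup>2 = sin (A y) * cos (A y)"
        using sin_nz[OF yS] by (simp add: cot_def power2_eq_square)
      then show ?thesis unfolding k_def s_def t_def by (metis of_real_mult of_real_power)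
    qed
    have nz: "a y + b \<noteq> 0" "cnj (a y) + b \<noteq> 0"
      using ab_nz[OF yS] by (metis, metis complex_cnj_add complex_cnj_complex_of_real complex_cnj_zero_iff)
    have "complex_of_real (E y)
        = k * ((a y - b) * (cnj (a y) - b) + 3/2 * \<rho> * s\<^sup>2) / ((a y + b) * (cnj (a y) + b))"
      using complex_norm_square[of "a y - b"] complex_norm_square[of "a y + b"]
      by (simp add: E_def k_def s_def)
    then have "of_real (E y) * ((a y + b) * (cnj (a y) + b))
        = k * ((a y - b) * (cnj (a y) - b) + 3/2 * \<rho> * s\<^sup>2)"
      using nz by simp
    also have "\<dots> = k * (a y - b) * (cnj (a y) - b) + 3/2 * \<rho> * s * t"
      using ks by (simp add: algebra_simps)
    finally have K: "of_real (E y) * ((a y + b) * (cnj (a y) + b))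
        = k * (a y - b) * (cnj (a y) - b) + 3/2 * \<rho> * s * t" .
    define w where "w = wedge (\<Phi> y) (\<lambda>u. cnj (\<Phi> y u)) u v"
    have 1: "of_real (A' y u) * \<Phi> y v - of_real (A' y v) * \<Phi> y u = - (cnj (a y) + b) * w"
      unfolding A'_def dA[OF yS] w_def wedge_def by (simp add: algebra_simps)
    have 2: "a' y u * \<Phi> y v - a' y v * \<Phi> y u
        = - (2 * a y * (cnj (a y) - b) * k + 3/2 * \<rho> * s * t) * w"
      using da[OF yS, of u v] by (simp add: wedge_def a'_def w_def k_def s_def t_def)
    have 3: "\<Phi>' y u v - \<Phi>' y v u = (cnj (a y) - b) * k * w"
      using d\<Phi>[OF yS, of v u] by (simp add: \<Phi>'_def w_def k_def)
    have "D y u v - D y v u = 2 * hh * (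
        - of_real (E y) * (a y + b) * (of_real (A' y u) * \<Phi> y v - of_real (A' y v) * \<Phi> y u)
        + (a' y u * \<Phi> y v - a' y v * \<Phi> y u) + (a y + b) * (\<Phi>' y u v - \<Phi>' y v u))"
      by (simp add: D_def hh_def algebra_simps)
    also have "\<dots> = 2 * hh * w * (of_real (E y) * ((a y + b) * (cnj (a y) + b))
        - (2 * a y * (cnj (a y) - b) * k + 3/2 * \<rho> * s * t) + (a y + b) * (cnj (a y) - b) * k)"
      unfolding 1 2 3 by (simp add: algebra_simps)
    also have "\<dots> = 0"
      unfolding K by (simp add: algebra_simps)
    finally show ?thesis by simp
  qed
  have lin\<omega>: "linear (\<omega> y)" if "y \<in> B" for y
  proof -
    interpret linear "\<Phi> y" using lin BS[OF that] .
    show ?thesis by (intro linearI) (simp_all add: \<omega>_def add scale algebra_simps)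
  qed
  obtain W0 where W0: "\<And>y. y \<in> B \<Longrightarrow> (W0 has_derivative \<omega> y) (at y)"
    using closed_form_exact_on_ball[of y0 r \<omega> D] lin\<omega> D\<omega> contD closed unfolding B_def by blast
  have "\<exists>c. \<forall>y\<in>B. Re (W0 y) - H (A y) = c"
  proof (rule has_derivative_zero_constant)
    show "convex B" by (simp add: B_def)
    fix y assume y: "y \<in> B"
    have HA: "((\<lambda>y. H (A y)) has_derivative (\<lambda>v. h (A y) * A' y v)) (at y)"
      using has_derivative_compose[OF A'[OF BS[OF y]], of H "(*) (h (A y))"]
        H[OF BA[OF y]] by (simp add: has_field_derivative_def)
    have "Re (\<omega> y v) = h (A y) * A' y v" for v
    proof -
      have "A' y v = Re (of_real (A' y v))" by simp
      also have "\<dots> = 2 * Re ((a y + b) * \<Phi> y v)"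
        unfolding A'_def dA[OF BS[OF y]] by (simp add: algebra_simps)
      finally have "A' y v = 2 * Re ((a y + b) * \<Phi> y v)" .
      moreover have "\<omega> y v = of_real (2 * h (A y)) * ((a y + b) * \<Phi> y v)"
        by (simp add: \<omega>_def)
      ultimately show ?thesis by (simp only: Re_complex_of_real Im_complex_of_real times_complex.sel)
    qed
    then have "((\<lambda>y. Re (W0 y) - H (A y)) has_derivative (\<lambda>v. 0)) (at y)"
      using has_derivative_diff[OF has_derivative_Re[OF W0[OF y]] HA] by simp
    then show "((\<lambda>y. Re (W0 y) - H (A y)) has_derivative (\<lambda>v. 0)) (at y within B)"
      by (rule has_derivative_at_withinI)
  qed
  then obtain c where c: "\<And>y. y \<in> B \<Longrightarrow> Re (W0 y) = H (A y) + c"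
    by (metis add.commute diff_add_cancel)
  show thesis
  proof (rule that[of r W0 h "\<lambda>s. H s + c"])
    show "r > 0" "ball y0 r \<subseteq> S" using r by auto
    show "(W0 has_derivative (\<lambda>u. 2 * of_real (h (A y)) * (a y + of_real b) * \<Phi> y u)) (at y)"
      if "y \<in> ball y0 r" for y
      using W0[of y] that by (simp add: B_def \<omega>_def[abs_def])
    show "inj_on (\<lambda>s. H s + c) (A ` ball y0 r)"
      using injH BA unfolding inj_on_def B_def by auto
  qed (use hpos c in \<open>auto simp: B_def\<close>)
qed

section \<open>Charts and complex coordinates\<close>

lemma homeomorphic_map_open_image:
  assumes "homeomorphic_map (subtopology X V) (top_of_set (g ` V)) g" "open (g ` V)"
    and "openin X U" "U \<subseteq> V"
  shows "open (g ` U)"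
proof -
  have "openin (subtopology X V) U"
    using assms(3,4) by (metis inf.orderE openin_subtopology_Int)
  then have "openin (top_of_set (g ` V)) (g ` U)"
    using homeomorphic_imp_open_map[OF assms(1)] by (simp add: open_map_def)
  then show ?thesis using assms(2) openin_open_eq by blast
qed

lemma homeomorphic_map_openin_vimage:
  assumes "homeomorphic_map (subtopology X V) (top_of_set (g ` V)) g" "openin X V" "open T"
  shows "openin X {q \<in> V. g q \<in> T}"
proof -
  have V: "topspace (subtopology X V) = V"
    using openin_subset[OF assms(2)] by auto
  have "openin (top_of_set (g ` V)) (g ` V \<inter> T)"
    using assms(3) by (simp add: openin_open_Int)
  from openin_continuous_map_preimage[OF homeomorphic_imp_continuous_map[OF assms(1)] this]
  have "openin (subtopology X V) {q \<in> V. g q \<in> g ` V \<inter> T}" unfolding V .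
  moreover have "{q \<in> V. g q \<in> g ` V \<inter> T} = {q \<in> V. g q \<in> T}" by auto
  ultimately show ?thesis using assms(2) openin_trans_full by fastforce
qed

lemma homeomorphic_map_inj_on:
  assumes "homeomorphic_map (subtopology X V) (top_of_set (g ` V)) g" "openin X V"
  shows "inj_on g V"
proof -
  have V: "topspace (subtopology X V) = V"
    using openin_subset[OF assms(2)] by auto
  show ?thesis using homeomorphic_imp_injective_map[OF assms(1)] unfolding V .
qed

lemma chart_domain_open:
  assumes "smooth_manifold M" "k \<in> atlas M" "openin (mtop M) U"
  shows "open (snd k ` (fst k \<inter> U))"
proof -
  have "homeomorphic_map (subtopology (mtop M) (fst k)) (top_of_set (snd k ` fst k)) (snd k)"
    "open (snd k ` fst k)" "openin (mtop M) (fst k \<inter> U)"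
    using assms by (auto simp: smooth_manifold_def)
  then show ?thesis by (rule homeomorphic_map_open_image) auto
qed

lemma chart_inv_into:
  assumes "smooth_manifold M" "k \<in> atlas M" "q \<in> fst k"
  shows "inv_into (fst k) (snd k) (snd k q) = q"
  using assms by (intro inv_into_f_f homeomorphic_map_inj_on) (auto simp: smooth_manifold_def)

lemma complex_coordinate_has_derivative:
  assumes z: "complex_coordinate M \<alpha> \<phi> V z lam"
    and q: "q \<in> V" "k \<in> charts_at (atlas M) q"
  shows "((\<lambda>y. z (inv_into (fst k) (snd k) y)) has_derivative coord_deriv k z q) (at (snd k q))"
  using smooth_on_has_derivative[of "snd k ` (fst k \<inter> V)" _ "snd k q"] z q
  by (auto simp: complex_coordinate_def smooth_fn_def smooth_in_def charts_at_def coord_deriv_def[abs_def])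

text \<open>Since \<open>\<phi> = \<lambda> dz\<close> and \<open>dw = w'(z) dz\<close>, the new factor is \<open>\<lambda> / w'(z)\<close>; injectivity keeps \<open>w'\<close> away
  from zero.\<close>

lemma complex_coordinate_holomorphic_change:
  assumes man: "smooth_manifold M" and z: "complex_coordinate M \<alpha> \<phi> V z lam"
    and V': "openin (mtop M) V'" "V' \<subseteq> V"
    and w: "w holomorphic_on (z ` V')" "inj_on w (z ` V')"
  shows "complex_coordinate M \<alpha> \<phi> V' (\<lambda>q. w (z q)) (\<lambda>q. lam q / deriv w (z q))"
proof -
  have hm: "homeomorphic_map (subtopology (mtop M) V) (top_of_set (z ` V)) z" "open (z ` V)"
    "openin (mtop M) V" "V \<subseteq> generic_part M \<alpha>" and sm: "smooth_fn M V z"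
    using z by (auto simp: complex_coordinate_def)
  have opz: "open (z ` U)" if "openin (mtop M) U" "U \<subseteq> V" for U
    using homeomorphic_map_open_image[OF hm(1,2)] that .
  have op: "open (z ` V')" using opz V' .
  have openw: "open (w ` z ` U)" if "openin (mtop M) U" "U \<subseteq> V'" for U
    using that V' w
    by (intro open_mapping_thm3 opz) (auto intro: holomorphic_on_subset inj_on_subset)
  have dnz: "deriv w (z q) \<noteq> 0" if "q \<in> V'" for q
    using holomorphic_injective_imp_regular[OF w(1) op w(2)] that by blast
  have top: "topspace (subtopology (mtop M) V') = V'"
    using openin_subset[OF V'(1)] by auto
  show ?thesis
    unfolding complex_coordinate_def
  proof (intro conjI ballI allI)
    show "openin (mtop M) V'" "V' \<subseteq> generic_part M \<alpha>" using V' hm by auto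
    show "open ((\<lambda>q. w (z q)) ` V')" using openw[OF V'(1)] by (simp add: image_image)
    show "smooth_fn M V' (\<lambda>q. w (z q))"
      unfolding smooth_fn_def smooth_in_def smooth_on_def
    proof (intro ballI allI)
      fix k n assume k: "k \<in> atlas M"
      show "Ck_on n (snd k ` (fst k \<inter> V')) (\<lambda>y. w (z (inv_into (fst k) (snd k) y)))"
      proof (rule Ck_on_holomorphic_compose[OF chart_domain_open[OF man k V'(1)] op _ w(1)])
        show "(\<lambda>y. z (inv_into (fst k) (snd k) y)) ` (snd k ` (fst k \<inter> V')) \<subseteq> z ` V'"
          using chart_inv_into[OF man k] by auto
        have "Ck_on n (snd k ` (fst k \<inter> V)) (\<lambda>y. z (inv_into (fst k) (snd k) y))"
          using sm k by (simp add: smooth_fn_def smooth_in_def smooth_on_def)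
        then show "Ck_on n (snd k ` (fst k \<inter> V')) (\<lambda>y. z (inv_into (fst k) (snd k) y))"
          by (rule Ck_on_subset) (use V'(2) in blast)
      qed
    qed
    show "homeomorphic_map (subtopology (mtop M) V') (top_of_set ((\<lambda>q. w (z q)) ` V')) (\<lambda>q. w (z q))"
    proof (rule bijective_open_imp_homeomorphic_map)
      have "continuous_map (subtopology (mtop M) V') (top_of_set (z ` V')) z"
        using continuous_map_from_subtopology_mono[OF continuous_map_into_fulltopology[OF
            homeomorphic_imp_continuous_map[OF hm(1)]] V'(2)]
        by (auto simp: continuous_map_in_subtopology)
      moreover have "continuous_map (top_of_set (z ` V')) (top_of_set (w ` z ` V')) w"
        using w(1) by (simp add: holomorphic_on_imp_continuous_on)
      ultimately show "continuous_map (subtopology (mtop M) V') (top_of_set ((\<lambda>q. w (z q)) ` V'))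
          (\<lambda>q. w (z q))"
        using continuous_map_compose[of _ _ z _ w] by (simp only: o_def image_image)
      show "open_map (subtopology (mtop M) V') (top_of_set ((\<lambda>q. w (z q)) ` V')) (\<lambda>q. w (z q))"
        unfolding open_map_def
      proof (intro allI impI)
        fix U assume "openin (subtopology (mtop M) V') U"
        then have U: "openin (mtop M) U" "U \<subseteq> V'"
          using V'(1) openin_trans_full openin_subset top by fastforce+
        then show "openin (top_of_set ((\<lambda>q. w (z q)) ` V')) ((\<lambda>q. w (z q)) ` U)"
          using openw[OF U] openw[OF V'(1) order_refl] U(2)
          by (intro open_openin_trans) (auto simp: image_image)
      qed
      show "(\<lambda>q. w (z q)) ` topspace (subtopology (mtop M) V') = topspace (top_of_set ((\<lambda>q. w (z q)) ` V'))"
        unfolding top by simp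
      show "inj_on (\<lambda>q. w (z q)) (topspace (subtopology (mtop M) V'))"
        unfolding top
        using comp_inj_on[OF inj_on_subset[OF homeomorphic_map_inj_on[OF hm(1,3)] V'(2)] w(2)]
        by (simp add: o_def)
    qed
    fix q assume q: "q \<in> V'"
    then have qV: "q \<in> V" using V' by blast
    show "lam q / deriv w (z q) \<noteq> 0"
      using z qV dnz[OF q] by (auto simp: complex_coordinate_def)
    fix k u assume k: "k \<in> charts_at (atlas M) q"
    then have k': "k \<in> atlas M" "q \<in> fst k" by (auto simp: charts_at_def)
    define g where "g y = z (inv_into (fst k) (snd k) y)" for y
    have gq: "g (snd k q) = z q" using chart_inv_into[OF man k'] by (simp add: g_def)
    have dg: "(g has_derivative coord_deriv k z q) (at (snd k q))"
      unfolding g_def using complex_coordinate_has_derivative[OF z qV k] .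
    have D: "((\<lambda>y. w (g y)) has_derivative (\<lambda>v. deriv w (z q) * frechet_derivative g (at (snd k q)) v))
        (at (snd k q))"
      using holomorphic_compose_has_derivative[OF w(1) op, of g "snd k q"] q gq dg
      by (auto simp: differentiable_def)
    have "coord_deriv k (\<lambda>q. w (z q)) q u = frechet_derivative (\<lambda>y. w (g y)) (at (snd k q)) u"
      by (simp add: coord_deriv_def g_def)
    also have "\<dots> = deriv w (z q) * coord_deriv k z q u"
      by (simp only: frechet_derivative_at[OF D, symmetric] frechet_derivative_at[OF dg, symmetric])
    finally show "\<phi> k q u = lam q / deriv w (z q) * coord_deriv k (\<lambda>q. w (z q)) q u"
      using z qV k dnz[OF q] by (simp add: complex_coordinate_def)
  qed
qed

text \<open>If \<open>Z\<close> is a real coordinate and \<open>dW = \<kappa> dZ\<close> with a complex factor \<open>\<kappa>\<close>, then \<open>W\<close>, expressed through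
  \<open>Z\<close>, satisfies the Cauchy-Riemann equations and has complex derivative \<open>\<kappa>\<close>.\<close>

lemma has_field_derivative_through_coordinate:
  fixes Z W \<Gamma> :: "complex \<Rightarrow> complex"
  assumes Z: "(Z has_derivative Z') (at (\<Gamma> \<zeta>))" and inj: "inj Z'"
    and \<Gamma>: "continuous (at \<zeta>) \<Gamma>" "open T" "\<zeta> \<in> T" "\<And>\<xi>. \<xi> \<in> T \<Longrightarrow> Z (\<Gamma> \<xi>) = \<xi>"
    and W: "(W has_derivative (\<lambda>u. \<kappa> * Z' u)) (at (\<Gamma> \<zeta>))"
  shows "((\<lambda>\<xi>. W (\<Gamma> \<xi>)) has_field_derivative \<kappa>) (at \<zeta>)"
proof -
  obtain g where g: "linear g" "\<And>u. g (Z' u) = u" "\<And>u. Z' (g u) = u"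
    using linear_injective_isomorphism[OF has_derivative_linear[OF Z] inj] by blast
  have "(\<Gamma> has_derivative g) (at \<zeta>)"
    by (rule has_derivative_inverse_basic[OF Z _ _ \<Gamma>(1-3)])
      (use g \<Gamma>(4) in \<open>auto simp: linear_conv_bounded_linear\<close>)
  from has_derivative_compose[OF this W] show ?thesis
    by (simp add: g(3) has_field_derivative_def)
qed

section \<open>The coordinate with real part a function of the Kaehler angle\<close>

text \<open>The structure equations hold in every chart, isothermal or not, so the primitive of
  \<open>structure_equations_primitive\<close> is available in any of them. That \<open>a + b\<close> does not vanish is
  automatic for an immersion of general type: \<open>a\<close> is nowhere real.\<close>

lemma structure_equations_primitive_in_chart:
  fixes M :: "('m, complex) riem" and \<phi> :: "'m form1" and b \<rho> :: real
  assumes man: "smooth_manifold M" and ogata: "structure_equations M \<rho> b \<alpha> \<phi> a c"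
    and general: "general_type M \<alpha> a"
    and sin_nz: "\<And>q. q \<in> generic_part M \<alpha> \<Longrightarrow> sin (\<alpha> q) \<noteq> 0"
    and G: "openin (mtop M) G" "G \<subseteq> generic_part M \<alpha>" "p \<in> G"
    and f: "\<And>q. q \<in> G \<Longrightarrow> a q = f (\<alpha> q)"
    and k: "k \<in> atlas M" "p \<in> fst k"
    and lin: "\<And>q. q \<in> fst k \<inter> G \<Longrightarrow> linear (\<phi> k q)"
  obtains r W h H where "r > 0" "ball (snd k p) r \<subseteq> snd k ` (fst k \<inter> G)"
    "\<And>q. q \<in> fst k \<Longrightarrow> snd k q \<in> ball (snd k p) r \<Longrightarrow>
       (W has_derivative (\<lambda>u. 2 * of_real (h (\<alpha> q)) * (a q + of_real b) * \<phi> k q u)) (at (snd k q))"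
    "\<And>s. h s > (0::real)"
    "\<And>q. q \<in> fst k \<Longrightarrow> snd k q \<in> ball (snd k p) r \<Longrightarrow> Re (W (snd k q)) = H (\<alpha> q)"
    "inj_on H (\<alpha> ` {q \<in> fst k. snd k q \<in> ball (snd k p) r})"
proof -
  have ab_nz: "a q + of_real b \<noteq> 0" if "q \<in> generic_part M \<alpha>" for q
  proof
    assume "a q + of_real b = 0"
    then have "a q = of_real (- b)" by (simp add: add_eq_0_iff)
    then have "a q = cnj (a q)" by simp
    then show False using general that unfolding general_type_def by blast
  qed
  define Y where "Y = snd k"
  define \<psi> where "\<psi> = inv_into (fst k) Y"
  have \<psi>Y: "\<psi> (Y q) = q" if "q \<in> fst k" for q
    using chart_inv_into[OF man k(1) that] by (simp add: \<psi>_def Y_def)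
  define S where "S = Y ` (fst k \<inter> G)"
  have opS: "open S"
    unfolding S_def Y_def using chart_domain_open[OF man k(1) G(1)] .
  have pS: "Y p \<in> S" using G(3) k(2) by (auto simp: S_def)
  have \<psi>S: "\<psi> y \<in> fst k \<inter> G" "\<psi> y \<in> generic_part M \<alpha>" "k \<in> charts_at (atlas M) (\<psi> y)" "Y (\<psi> y) = y"
    if "y \<in> S" for y
    using that \<psi>Y G(2) k(1) by (auto simp: S_def charts_at_def)
  have smooth_gen: "smooth_on S (\<lambda>y. g (\<psi> y))" if "smooth_in k (generic_part M \<alpha>) g"
    for g :: "'m \<Rightarrow> 'z::real_normed_vector"
    using that unfolding smooth_in_def \<psi>_def S_def Y_def
    by (rule smooth_on_subset) (use G(2) in blast)
  have cd: "coord_deriv k g (\<psi> y) = frechet_derivative (\<lambda>y. g (\<psi> y)) (at y)" if "y \<in> S"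
    for g :: "'m \<Rightarrow> 'z::real_normed_vector" and y
    using \<psi>S(4)[OF that] by (simp add: coord_deriv_def[abs_def] \<psi>_def Y_def)
  note O = ogata[unfolded structure_equations_def Let_def]
  let ?A = "\<lambda>y. \<alpha> (\<psi> y)" and ?a = "\<lambda>y. a (\<psi> y)" and ?\<Phi> = "\<lambda>y. \<phi> k (\<psi> y)"
  show thesis
  proof (rule structure_equations_primitive[of S "Y p" ?A ?a ?\<Phi> b f \<rho>, OF opS pS])
    show "smooth_on S ?A" "smooth_on S ?a"
      using O k(1) by (auto intro!: smooth_gen simp: smooth_fn_def)
    show "smooth_on S (\<lambda>y. ?\<Phi> y u)" for u
      using smooth_gen[of "\<lambda>q. \<phi> k q u"] O k(1) by blast
    fix y assume y: "y \<in> S"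
    note gen = \<psi>S(2)[OF y] and ch = \<psi>S(3)[OF y]
    show "linear (?\<Phi> y)" using lin \<psi>S(1)[OF y] .
    show "\<exists>u. frechet_derivative ?A (at y) u \<noteq> 0"
      using general gen ch unfolding cd[OF y, symmetric] general_type_def by blast
    show "sin (?A y) \<noteq> 0" "?a y + of_real b \<noteq> 0" using sin_nz ab_nz gen by auto
    show "?a y = f (?A y)" using f \<psi>S(1)[OF y] by blast
    show "of_real (frechet_derivative ?A (at y) u)
        = (?a y + of_real b) * ?\<Phi> y u + (cnj (?a y) + of_real b) * cnj (?\<Phi> y u)" for u
      using O gen ch unfolding cd[OF y, symmetric] by blast
    have "ext_deriv \<phi> k (\<psi> y) u v
        = (cnj (?a y) - of_real b) * of_real (cot (?A y)) * wedge (?\<Phi> y) (\<lambda>u. cnj (?\<Phi> y u)) u v"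
      for u v
      using O gen ch by (auto simp: cot_of_real)
    then show "frechet_derivative (\<lambda>y. ?\<Phi> y v) (at y) u - frechet_derivative (\<lambda>y. ?\<Phi> y u) (at y) v
        = (cnj (?a y) - of_real b) * of_real (cot (?A y)) * wedge (?\<Phi> y) (\<lambda>u. cnj (?\<Phi> y u)) u v"
      for u v
      unfolding ext_deriv_def cd[OF y] .
    have "wedge (coord_deriv k a (\<psi> y)) (?\<Phi> y) u v
        = - (2 * ?a y * (cnj (?a y) - b) * cot (?A y) + 3 / 2 * \<rho> * sin (?A y) * cos (?A y))
          * wedge (?\<Phi> y) (\<lambda>u. cnj (?\<Phi> y u)) u v" for u v
      using O gen ch by blast
    then show "wedge (frechet_derivative ?a (at y)) (?\<Phi> y) u v
        = - (2 * ?a y * (cnj (?a y) - of_real b) * of_real (cot (?A y))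
             + 3 / 2 * of_real \<rho> * of_real (sin (?A y)) * of_real (cos (?A y)))
          * wedge (?\<Phi> y) (\<lambda>u. cnj (?\<Phi> y u)) u v" for u v
      unfolding cd[OF y] by (simp add: cot_of_real sin_of_real cos_of_real)
  next
    fix r :: real and W h H
    assume prim: "r > 0" "ball (Y p) r \<subseteq> S"
      "\<And>y. y \<in> ball (Y p) r \<Longrightarrow>
         (W has_derivative (\<lambda>u. 2 * of_real (h (?A y)) * (?a y + of_real b) * ?\<Phi> y u)) (at y)"
      "\<And>s. h s > (0::real)" "\<And>y. y \<in> ball (Y p) r \<Longrightarrow> Re (W y) = H (?A y)"
      "inj_on H (?A ` ball (Y p) r)"
    have img: "\<alpha> ` {q \<in> fst k. Y q \<in> ball (Y p) r} \<subseteq> ?A ` ball (Y p) r"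
      using \<psi>Y by force
    show thesis
    proof (rule that[of r W h H, folded Y_def])
      show "ball (Y p) r \<subseteq> Y ` (fst k \<inter> G)" using prim(2) by (simp add: S_def)
      fix q assume q: "q \<in> fst k" "Y q \<in> ball (Y p) r"
      show "(W has_derivative (\<lambda>u. 2 * of_real (h (\<alpha> q)) * (a q + of_real b) * \<phi> k q u)) (at (Y q))"
        "Re (W (Y q)) = H (\<alpha> q)"
        using prim(3)[OF q(2)] prim(5)[OF q(2)] by (simp_all add: \<psi>Y[OF q(1)])
    qed (use prim(1,4) inj_on_subset[OF prim(6) img] in auto)
  qed
qed

theorem lemma2p4:
  fixes M :: "('m, complex) riem" and N :: "('n, complex^2) riem" and x :: "'m \<Rightarrow> 'n"
    and \<rho> b :: real and \<alpha> :: "'m \<Rightarrow> real"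
    and \<omega>1 \<omega>2 :: "('n, complex^2) chart \<Rightarrow> 'm \<Rightarrow> complex^2 \<Rightarrow> complex"
    and \<phi> :: "'m form1" and a c :: "'m \<Rightarrow> complex"
    and V :: "'m set" and z lam :: "'m \<Rightarrow> complex"
  assumes surface: "oriented_surface M"
    and space_form: "complex_space_form \<rho> N"
    and immersion: "isometric_immersion M N x"
    and parallel: "parallel_mean_curvature M N x"
    and b_pos: "b > 0"
    and length_H: "mean_curvature_length M N x (2 * b)"
    and angle: "kaehler_angle M N x \<alpha>"
    and coframe: "adapted_coframe M N x b \<alpha> \<omega>1 \<omega>2 \<phi> a c"
    and ogata: "structure_equations M \<rho> b \<alpha> \<phi> a c"
    and general: "general_type M \<alpha> a"
    and known: "general_type M \<alpha> a \<longrightarrow> locally_function_of M \<alpha> a"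
    and coordinate: "complex_coordinate M \<alpha> \<phi> V z lam"
  shows "\<forall>p\<in>V. \<exists>V' w \<mu> m. p \<in> V' \<and> V' \<subseteq> V \<and> w holomorphic_on (z ` V') \<and> inj_on w (z ` V') \<and>
           complex_coordinate M \<alpha> \<phi> V' (\<lambda>q. w (z q)) \<mu> \<and>
           (\<forall>q\<in>V'. \<mu> q = (m :: real \<Rightarrow> complex) (Re (w (z q))))"
proof
  fix p assume p: "p \<in> V"
  have riem: "riemannian_manifold M" and man: "smooth_manifold M"
    using surface unfolding oriented_surface_def riemannian_manifold_def by blast+
  have V: "openin (mtop M) V" "V \<subseteq> generic_part M \<alpha>" "open (z ` V)"
    and hmz: "homeomorphic_map (subtopology (mtop M) V) (top_of_set (z ` V)) z"
    and lam: "\<And>q. q \<in> V \<Longrightarrow> lam q \<noteq> 0"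
    and \<phi>z: "\<And>q k u. q \<in> V \<Longrightarrow> k \<in> charts_at (atlas M) q \<Longrightarrow> \<phi> k q u = lam q * coord_deriv k z q u"
    using coordinate unfolding complex_coordinate_def by blast+
  have injz: "inj_on z V" using homeomorphic_map_inj_on[OF hmz V(1)] .
  have gen_top: "generic_part M \<alpha> \<subseteq> topspace (mtop M)" by (auto simp: generic_part_def)
  have sin_nz: "sin (\<alpha> q) \<noteq> 0" if "q \<in> generic_part M \<alpha>" for q
  proof -
    have "0 < \<alpha> q" "\<alpha> q < pi"
      using angle that by (fastforce simp: kaehler_angle_def generic_part_def)+
    then show ?thesis using sin_gt_zero by fastforce
  qed
  have ab_nz: "a q + of_real b \<noteq> 0" if "q \<in> generic_part M \<alpha>" for q
  proof
    assume "a q + of_real b = 0"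
    then have "a q = of_real (- b)" by (simp add: add_eq_0_iff)
    then have "a q = cnj (a q)" by simp
    then show False using general that unfolding general_type_def by blast
  qed
  \<comment> \<open>\<open>\<phi> \<phi>\<bar>\<close> is the metric, so \<open>\<phi>\<close> has no kernel; hence neither has \<open>dz\<close>.\<close>
  have \<phi>_nz: "u = 0" if "q \<in> generic_part M \<alpha>" "k \<in> charts_at (atlas M) q" "\<phi> k q u = 0" for q k u
  proof (rule ccontr)
    assume "u \<noteq> 0"
    then have "metric M k q u u > 0"
      using riem that(1,2) gen_top unfolding riemannian_manifold_def by blast
    moreover have "metric M k q u u = Re (\<phi> k q u * cnj (\<phi> k q u))"
      using coframe that(1,2) unfolding adapted_coframe_def by blast
    ultimately show False using that(3) by simp
  qed
  obtain G f where G: "openin (mtop M) G" "p \<in> G" and f: "\<And>q. q \<in> G \<Longrightarrow> a q = f (\<alpha> q)"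
  proof -
    have "\<forall>p\<in>generic_part M \<alpha>. \<exists>W f. openin (mtop M) W \<and> p \<in> W \<and> W \<subseteq> generic_part M \<alpha> \<and>
        (\<forall>q\<in>W. a q = f (\<alpha> q))"
      using known general unfolding locally_function_of_def by (rule mp)
    from bspec[OF this subsetD[OF V(2) p]] show thesis using that by blast
  qed
  have "topspace (mtop M) = (\<Union>k\<in>atlas M. fst k)"
    using man unfolding smooth_manifold_def by blast
  then have "p \<in> (\<Union>k\<in>atlas M. fst k)" using p V(2) gen_top by blast
  then obtain k where k: "k \<in> atlas M" "p \<in> fst k" by blast
  define Y where "Y = snd k"
  have Y_inv: "inv_into (fst k) Y (Y q) = q" if "q \<in> fst k" for q
    using chart_inv_into[OF man k(1) that] by (simp add: Y_def)
  have hmY: "homeomorphic_map (subtopology (mtop M) (fst k)) (top_of_set (Y ` fst k)) Y"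
    and opk: "openin (mtop M) (fst k)"
    using man k(1) unfolding smooth_manifold_def Y_def by blast+
  have dZ: "((\<lambda>y. z (inv_into (fst k) Y y)) has_derivative coord_deriv k z q) (at (Y q))"
    if "q \<in> fst k \<inter> V" for q
    using complex_coordinate_has_derivative[OF coordinate, of q k] that k(1)
    by (simp add: charts_at_def Y_def)
  have lin\<phi>: "linear (\<phi> k q)" if "q \<in> fst k \<inter> (V \<inter> G)" for q
  proof -
    have q: "q \<in> V" "k \<in> charts_at (atlas M) q" using that k(1) by (auto simp: charts_at_def)
    have "linear (coord_deriv k z q)"
      using dZ[of q] that has_derivative_linear by auto
    then interpret L: linear "coord_deriv k z q" .
    show ?thesis
      by (intro linearI) (simp_all add: \<phi>z[OF q] L.add L.scale algebra_simps)
  qed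
  have VG: "openin (mtop M) (V \<inter> G)" "V \<inter> G \<subseteq> generic_part M \<alpha>" "p \<in> V \<inter> G"
    and fVG: "\<And>q. q \<in> V \<inter> G \<Longrightarrow> a q = f (\<alpha> q)"
    using V(1,2) G p f by auto
  obtain r W h H where r: "r > 0" "ball (Y p) r \<subseteq> Y ` (fst k \<inter> (V \<inter> G))"
    and W: "\<And>q. q \<in> fst k \<Longrightarrow> Y q \<in> ball (Y p) r \<Longrightarrow> (W has_derivative
        (\<lambda>u. 2 * of_real (h (\<alpha> q)) * (a q + of_real b) * \<phi> k q u)) (at (Y q))"
    and hpos: "\<And>s. h s > (0::real)"
    and ReW: "\<And>q. q \<in> fst k \<Longrightarrow> Y q \<in> ball (Y p) r \<Longrightarrow> Re (W (Y q)) = H (\<alpha> q)"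
    and injH: "inj_on H (\<alpha> ` {q \<in> fst k. Y q \<in> ball (Y p) r})"
    unfolding Y_def
    by (rule structure_equations_primitive_in_chart[OF man ogata general sin_nz VG fVG k lin\<phi>])
      (assumption | use that in \<open>unfold Y_def, blast\<close>)+
  define U where "U = {q \<in> fst k. Y q \<in> ball (Y p) r}"
  have opU: "openin (mtop M) U"
    unfolding U_def by (rule homeomorphic_map_openin_vimage[OF hmY opk open_ball])
  have UV: "U \<subseteq> fst k \<inter> (V \<inter> G)"
  proof
    fix q assume "q \<in> U"
    then have "q \<in> fst k" "Y q \<in> Y ` (fst k \<inter> (V \<inter> G))" using r(2) by (auto simp: U_def)
    then obtain q' where "q' \<in> fst k \<inter> (V \<inter> G)" "Y q = Y q'" by blast
    then show "q \<in> fst k \<inter> (V \<inter> G)" using Y_inv \<open>q \<in> fst k\<close> by (metis IntD1)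
  qed
  have pU: "p \<in> U" using k r by (simp add: U_def)
  have opzU: "open (z ` U')" if "openin (mtop M) U'" "U' \<subseteq> U" for U'
    using homeomorphic_map_open_image[OF hmz V(3)] that UV by blast
  \<comment> \<open>The change from the coordinate \<open>z\<close> to the chart \<open>k\<close>.\<close>
  define \<Gamma> where "\<Gamma> \<zeta> = Y (inv_into V z \<zeta>)" for \<zeta>
  have \<Gamma>z: "\<Gamma> (z q) = Y q" if "q \<in> U" for q
    using that UV injz by (simp add: \<Gamma>_def subset_eq)
  have cont\<Gamma>: "continuous_on (z ` U) \<Gamma>"
    unfolding continuous_on_open_vimage[OF opzU[OF opU order_refl]]
  proof (intro allI impI)
    fix T :: "complex set" assume "open T"
    then have "openin (mtop M) ({q \<in> fst k. Y q \<in> T} \<inter> U)"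
      using homeomorphic_map_openin_vimage[OF hmY opk] opU by blast
    then have "open (z ` ({q \<in> fst k. Y q \<in> T} \<inter> U))" by (intro opzU) auto
    moreover have "z ` ({q \<in> fst k. Y q \<in> T} \<inter> U) = \<Gamma> -` T \<inter> z ` U"
      using \<Gamma>z by (auto simp: U_def)
    ultimately show "open (\<Gamma> -` T \<inter> z ` U)" by simp
  qed
  \<comment> \<open>\<open>dW = 2 h(\<alpha>) (a + b) \<phi> = 2 h(\<alpha>) (a + b) lam dz\<close>, so \<open>W\<close> is a holomorphic function of \<open>z\<close>.\<close>
  define w where "w \<zeta> = W (\<Gamma> \<zeta>)" for \<zeta>
  have dw: "(w has_field_derivative 2 * of_real (h (\<alpha> q)) * (a q + of_real b) * lam q) (at (z q))"
    if q: "q \<in> U" for q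
    unfolding w_def
  proof (rule has_field_derivative_through_coordinate[where Z = "\<lambda>y. z (inv_into (fst k) Y y)"
        and Z' = "coord_deriv k z q" and \<Gamma> = \<Gamma> and W = W and T = "z ` U"])
    have ch: "k \<in> charts_at (atlas M) q" and qV: "q \<in> V" "q \<in> fst k" "q \<in> generic_part M \<alpha>"
      using q UV V(2) k(1) by (auto simp: charts_at_def)
    have "q \<in> fst k \<inter> V" using qV by simp
    then show dzq: "((\<lambda>y. z (inv_into (fst k) Y y)) has_derivative coord_deriv k z q) (at (\<Gamma> (z q)))"
      unfolding \<Gamma>z[OF q] by (rule dZ)
    have "\<phi> k q u = 0" if "coord_deriv k z q u = 0" for u
      using \<phi>z[OF qV(1) ch, of u] that by simp
    then show "inj (coord_deriv k z q)"
      unfolding linear_injective_0[OF has_derivative_linear[OF dzq]]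
      using \<phi>_nz[OF qV(3) ch] by blast
    show "continuous (at (z q)) \<Gamma>"
      using cont\<Gamma> opzU[OF opU order_refl] q by (simp add: continuous_on_eq_continuous_at)
    show "open (z ` U)" "z q \<in> z ` U" using opzU[OF opU order_refl] q by auto
    show "z (inv_into (fst k) Y (\<Gamma> \<xi>)) = \<xi>" if "\<xi> \<in> z ` U" for \<xi>
      using that \<Gamma>z Y_inv UV by auto
    have "Y q \<in> ball (Y p) r" using q by (simp add: U_def)
    from W[OF qV(2) this]
    show "(W has_derivative (\<lambda>u. 2 * of_real (h (\<alpha> q)) * (a q + of_real b) * lam q * coord_deriv k z q u))
        (at (\<Gamma> (z q)))"
      by (simp add: \<Gamma>z[OF q] \<phi>z[OF qV(1) ch] mult.assoc)
  qed
  have hol: "w holomorphic_on z ` U"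
    unfolding holomorphic_on_open[OF opzU[OF opU order_refl]] using dw by blast
  have dwq: "deriv w (z q) = 2 * of_real (h (\<alpha> q)) * (a q + of_real b) * lam q" if "q \<in> U" for q
    using dw[OF that] by (rule DERIV_imp_deriv)
  have gen: "q \<in> V \<and> q \<in> generic_part M \<alpha>" if "q \<in> U" for q using that UV V(2) by blast
  have dnz: "deriv w (z q) \<noteq> 0" if "q \<in> U" for q
    using gen[OF that] hpos[of "\<alpha> q"] ab_nz lam by (simp add: dwq[OF that])
  obtain e where e: "e > 0" "ball (z p) e \<subseteq> z ` U" and injw: "inj_on w (ball (z p) e)"
    by (rule has_complex_derivative_locally_injective[OF hol imageI[OF pU] opzU[OF opU order_refl]
          dnz[OF pU]])
  define V' where "V' = {q \<in> V. z q \<in> ball (z p) e}"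
  have V'U: "V' \<subseteq> U"
  proof
    fix q assume "q \<in> V'"
    then obtain q' where "q' \<in> U" "z q = z q'" "q \<in> V" using e(2) by (auto simp: V'_def)
    then show "q \<in> U" using injz UV by (metis IntD1 IntD2 inj_onD subsetD)
  qed
  have opV': "openin (mtop M) V'"
    unfolding V'_def by (rule homeomorphic_map_openin_vimage[OF hmz V(1) open_ball])
  have zV': "z ` V' \<subseteq> ball (z p) e" by (auto simp: V'_def)
  \<comment> \<open>The factor of \<open>\<phi>\<close> with respect to \<open>w\<close>, in which \<open>lam\<close> has cancelled: it depends on
    \<open>\<alpha>\<close> alone, because \<open>a = f(\<alpha>)\<close>.\<close>
  define \<mu> where "\<mu> q = 1 / (2 * of_real (h (\<alpha> q)) * (a q + of_real b))" for q
  have \<mu>: "lam q / deriv w (z q) = \<mu> q" if "q \<in> V'" for q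
    using gen[of q] that V'U lam[of q] dwq[of q] by (auto simp: \<mu>_def)
  have pV': "p \<in> V'" "V' \<subseteq> V" using p e(1) by (auto simp: V'_def)
  have wV': "w holomorphic_on z ` V'" "inj_on w (z ` V')"
    using holomorphic_on_subset[OF hol image_mono[OF V'U]] inj_on_subset[OF injw zV'] by auto
  have coord: "complex_coordinate M \<alpha> \<phi> V' (\<lambda>q. w (z q)) (\<lambda>q. lam q / deriv w (z q))"
    using complex_coordinate_holomorphic_change[OF man coordinate opV' pV'(2) wV'] .
  \<comment> \<open>\<open>Re w = H(\<alpha>)\<close> with \<open>H\<close> injective, so \<open>Re w\<close> determines \<open>\<alpha>\<close> and with it \<open>\<mu>\<close>.\<close>
  have same: "\<mu> q = \<mu> q'" if "q \<in> V'" "q' \<in> V'" "Re (w (z q)) = Re (w (z q'))" for q q'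
  proof -
    have *: "Re (w (z q)) = H (\<alpha> q)" "\<alpha> q \<in> \<alpha> ` {q \<in> fst k. Y q \<in> ball (Y p) r}" "a q = f (\<alpha> q)"
      if "q \<in> V'" for q
    proof -
      have q: "q \<in> U" "q \<in> fst k" "Y q \<in> ball (Y p) r" using that V'U by (auto simp: U_def)
      show "Re (w (z q)) = H (\<alpha> q)" using ReW[OF q(2,3)] by (simp add: w_def \<Gamma>z q)
      show "\<alpha> q \<in> \<alpha> ` {q \<in> fst k. Y q \<in> ball (Y p) r}"
        using q by blast
      show "a q = f (\<alpha> q)" using f q(1) UV by blast
    qed
    have "H (\<alpha> q) = H (\<alpha> q')" using that(3) *(1)[OF that(1)] *(1)[OF that(2)] by simp
    then have "\<alpha> q = \<alpha> q'" by (rule inj_onD[OF injH _ *(2)[OF that(1)] *(2)[OF that(2)]])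
    then show ?thesis using *(3)[OF that(1)] *(3)[OF that(2)] by (simp add: \<mu>_def)
  qed
  have m: "\<mu> q = \<mu> (SOME q'. q' \<in> V' \<and> Re (w (z q')) = Re (w (z q)))" if "q \<in> V'" for q
  proof -
    let ?P = "\<lambda>q'. q' \<in> V' \<and> Re (w (z q')) = Re (w (z q))"
    have "?P (SOME q'. ?P q')" by (rule someI[of ?P q]) (simp add: that)
    then show ?thesis using same that by metis
  qed
  show "\<exists>V' w \<mu> m. p \<in> V' \<and> V' \<subseteq> V \<and> w holomorphic_on (z ` V') \<and> inj_on w (z ` V') \<and>
           complex_coordinate M \<alpha> \<phi> V' (\<lambda>q. w (z q)) \<mu> \<and>
           (\<forall>q\<in>V'. \<mu> q = (m :: real \<Rightarrow> complex) (Re (w (z q))))"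
    by (intro exI[of _ V'] exI[of _ w] exI[of _ "\<lambda>q. lam q / deriv w (z q)"]
        exI[of _ "\<lambda>s. \<mu> (SOME q'. q' \<in> V' \<and> Re (w (z q')) = s)"])
      (simp add: pV' wV' coord \<mu> flip: m)
qed

end
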